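(* Every straight ruled surface in the Heisenberg group $\mathfrak{H}$ has zero horizontal mean curvature (at its non characteristic points) and is locally contactomorphic to the complex plane $\mathbb{C}=\{t=0\}$. Moreover, if a regular surface $\mathcal{S}$ in $\mathfrak{H}$ has everywhere (i.e. at all non characteristic points) zero horizontal mean curvature, then every sufficiently small portion of $\mathcal{S}$ comprising only of non characteristic points is a straight ruled surface.
   Context: The Heisenberg group $\mathfrak{H}$ is $\mathbb{R}^3$ with coordinates $(x,y,t)$ and group law $(x,y,t)*(x',y',t')=(x+x',y+y',t+t'+2(yx'-xy'))$. Left invariant vector fields: $X=\partial_x+2y\,\partial_t$, $Y=\partial_y-2x\,\partial_t$, $T=\partial_t$. Contact form: $\omega=dt+2(x\,dy-y\,dx)$. The horizontal plane at $p$ is $\mathbb{H}_p(\mathfrak{H})=\ker\omega_p=\mathrm{span}\{X_p,Y_p\}$, with inner product making $X,Y$ orthonormal and norm $\|\cdot\|$. The complex plane $\mathbb{C}$ is identified with $\{t=0\}$, and $pr_{\mathbb{C}}(x,y,t)=(x,y)$. A regular surface $\mathcal{S}$ in $\mathfrak{H}$ is an oriented smooth embedded regular surface of $\mathbb{R}^3$ (surface patches $\sigma(u,v)=(x(u,v),y(u,v),t(u,v))$ are smooth homeomorphisms onto their images with differential of rank 2, with orientation-preserving transition maps). Write $\partial(f,g)=f_ug_v-f_vg_u$. The horizontal normal is $$N^h_\sigma=\big(\partial(y,t)+2y\,\partial(x,y)\big)X+\big(\partial(t,x)-2x\,\partial(x,y)\big)Y .$$ A point $p\in\mathcal{S}$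 is characteristic if $N^h_p=0$ and non characteristic otherwise; the set $\mathfrak{C}(\mathcal{S})$ of characteristic points is the characteristic locus. At non characteristic points the unit horizontal normal is $\nu^h=N^h/\|N^h\|=\nu_1X+\nu_2Y$. The horizontal mean curvature at a non characteristic point $p$ is $H^h(p)=X_p\nu_1+Y_p\nu_2$, where $\nu_1,\nu_2$ are understood as smoothly extended to a neighbourhood of $p$ in $\mathfrak{H}$ with $\nu_1^2+\nu_2^2=1$ (the value does not depend on such an extension). The induced 1-form on $\mathcal{S}$ is $\omega_{\mathcal{S}}=\iota^*\omega$, with $\iota:\mathcal{S}\hookrightarrow\mathfrak{H}$ the inclusion. Two regular surfaces $\mathcal{S},\tilde{\mathcal{S}}$ are locally contactomorphic if there is a local diffeomorphism $f:\mathcal{S}\to\tilde{\mathcal{S}}$, defined away from the characteristic loci, and a smooth function $\lambda$ such that $f^*\omega_{\tilde{\mathcal{S}}}=\lambda\,\omega_{\mathcal{S}}$. Straight ruled surface: let $\gamma(s)=(x(s),y(s),t(s))$, $s$ in an open interval $I$, be a smooth (not necessarily horizontal) curve whose projection $pr_{\mathbb{C}}(\gamma)$ is not a straight line, and let $V(s)=a(s)X+b(s)Y\in\mathbb{H}_{\gamma(s)}(\mathfrak{H})$, $a^2+b^2=1$, be a smooth unit horizontal vector field along $\gamma$. The straight ruled surface $\mathcal{R}(\gamma)$ is the surface parametrised by the single patch $$\sigma(s,v)=\gamma(s)+vV(s)=\big(x(s)+va(s),\;y(s)+vb(s),\;t(s)+2v(y(s)a(s)-x(s)b(s))\big),$$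 with the parameters $(s,v)$ restricted to a domain on which $\sigma$ is a regular surface patch (for instance $v$ in a suitable open interval). *)

theory Defs
  imports "HOL-Analysis.Analysis"
begin

section \<open>Smooth maps\<close>

text \<open>
  The distribution has no notion of a \<open>C\<^sup>k\<close> map between normed spaces.  The definition below
  is meant for open \<open>S\<close>: all iterated directional derivatives exist and are continuous.
\<close>

primrec Ck_on :: "nat \<Rightarrow> 'a::real_normed_vector set \<Rightarrow> ('a \<Rightarrow> 'b::real_normed_vector) \<Rightarrow> bool" where
  "Ck_on 0 S f \<longleftrightarrow> continuous_on S f"
| "Ck_on (Suc k) S f \<longleftrightarrow>
     (\<forall>x\<in>S. f differentiable (at x)) \<and> (\<forall>v. Ck_on k S (\<lambda>x. frechet_derivative f (at x) v))"

definition smooth_on :: "'a::real_normed_vector set \<Rightarrow> ('a \<Rightarrow> 'b::real_normed_vector) \<Rightarrow> bool" where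
  "smooth_on S f \<longleftrightarrow> (\<forall>k. Ck_on k S f)"

section \<open>The Heisenberg group\<close>

type_synonym heis = "real \<times> real \<times> real"

text \<open>
  The left invariant fields \<open>X = \<partial>\<^sub>x + 2y \<partial>\<^sub>t\<close> and \<open>Y = \<partial>\<^sub>y - 2x \<partial>\<^sub>t\<close>
  of the group law \<open>(x,y,t)*(x',y',t') = (x+x', y+y', t+t'+2(yx'-xy'))\<close>, and the contact form
  \<open>\<omega> = dt + 2(x dy - y dx)\<close>, whose kernel at \<open>p\<close> is spanned by \<open>X\<^sub>p\<close> and \<open>Y\<^sub>p\<close>.
\<close>

fun XH :: "heis \<Rightarrow> heis" where "XH (x, y, t) = (1, 0, 2 * y)"
fun YH :: "heis \<Rightarrow> heis" where "YH (x, y, t) = (0, 1, - 2 * x)"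

fun contact_form :: "heis \<Rightarrow> heis \<Rightarrow> real" where
  "contact_form (x, y, t) (dx, dy, dt) = dt + 2 * (x * dy - y * dx)"

fun prC :: "heis \<Rightarrow> real \<times> real" where "prC (x, y, t) = (x, y)"

section \<open>Regular surfaces\<close>

definition xc :: "heis \<Rightarrow> real" where "xc p = fst p"
definition yc :: "heis \<Rightarrow> real" where "yc p = fst (snd p)"
definition tc :: "heis \<Rightarrow> real" where "tc p = snd (snd p)"

text \<open>\<open>\<partial>(f,g) = f\<^sub>u g\<^sub>v - f\<^sub>v g\<^sub>u\<close>\<close>

definition jac :: "(real \<times> real \<Rightarrow> real) \<Rightarrow> (real \<times> real \<Rightarrow> real) \<Rightarrow> real \<times> real \<Rightarrow> real" where
  "jac f g w =
     frechet_derivative f (at w) (1, 0) * frechet_derivative g (at w) (0, 1)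
   - frechet_derivative f (at w) (0, 1) * frechet_derivative g (at w) (1, 0)"

definition regular_patch :: "(real \<times> real) set \<Rightarrow> (real \<times> real \<Rightarrow> heis) \<Rightarrow> bool" where
  "regular_patch U \<sigma> \<longleftrightarrow>
     open U \<and> smooth_on U \<sigma> \<and>
     (\<exists>g. homeomorphism U (\<sigma> ` U) \<sigma> g) \<and>
     (\<forall>w\<in>U. dim (range (frechet_derivative \<sigma> (at w))) = 2)"

text \<open>
  An oriented surface is represented by an atlas: a set of pairs \<open>(U, \<sigma>)\<close> of a parameter domain
  and a patch.  Embeddedness is the requirement that the image of every patch is open in the
  subspace topology which the point set inherits from \<open>\<real>\<^sup>3\<close>; the orientation is the one for which
  all patches of the atlas are positive.
\<close>

type_synonym surface = "((real \<times> real) set \<times> (real \<times> real \<Rightarrow> heis)) set"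

definition surface_points :: "surface \<Rightarrow> heis set" where
  "surface_points S = (\<Union>(U, \<sigma>)\<in>S. \<sigma> ` U)"

definition regular_surface :: "surface \<Rightarrow> bool" where
  "regular_surface S \<longleftrightarrow>
     (\<forall>(U, \<sigma>)\<in>S. regular_patch U \<sigma> \<and> openin (top_of_set (surface_points S)) (\<sigma> ` U)) \<and>
     (\<forall>(U, \<sigma>)\<in>S. \<forall>(V, \<tau>)\<in>S. \<forall>w\<in>U. \<sigma> w \<in> \<tau> ` V \<longrightarrow>
        jac (fst \<circ> (inv_into V \<tau> \<circ> \<sigma>)) (snd \<circ> (inv_into V \<tau> \<circ> \<sigma>)) w > 0)"

section \<open>Horizontal normal and horizontal mean curvature\<close>

text \<open>
  Horizontal vectors \<open>a X + b Y\<close> are represented by their components \<open>(a, b)\<close>.  Since \<open>X\<close>, \<open>Y\<close>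
  are orthonormal, the norm of a horizontal vector is the Euclidean norm of \<open>(a, b)\<close>, and
  \<open>N / \<parallel>N\<parallel>\<close> is \<open>sgn N\<close>.
\<close>

definition hnormal :: "(real \<times> real \<Rightarrow> heis) \<Rightarrow> real \<times> real \<Rightarrow> real \<times> real" where
  "hnormal \<sigma> w =
     (jac (yc \<circ> \<sigma>) (tc \<circ> \<sigma>) w + 2 * yc (\<sigma> w) * jac (xc \<circ> \<sigma>) (yc \<circ> \<sigma>) w,
      jac (tc \<circ> \<sigma>) (xc \<circ> \<sigma>) w - 2 * xc (\<sigma> w) * jac (xc \<circ> \<sigma>) (yc \<circ> \<sigma>) w)"

definition char_locus :: "surface \<Rightarrow> heis set" where
  "char_locus S = {p. \<exists>(U, \<sigma>)\<in>S. \<exists>w\<in>U. \<sigma> w = p \<and> hnormal \<sigma> w = 0}"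

definition noncharacteristic_points :: "surface \<Rightarrow> heis set" where
  "noncharacteristic_points S = surface_points S - char_locus S"

text \<open>
  \<open>h = X\<^sub>p \<nu>\<^sub>1 + Y\<^sub>p \<nu>\<^sub>2\<close> for some smooth unit extension \<open>(\<nu>\<^sub>1, \<nu>\<^sub>2)\<close> of the unit horizontal
  normal to a neighbourhood \<open>W\<close> of \<open>p\<close> in the Heisenberg group.
\<close>

definition has_horizontal_mean_curvature :: "surface \<Rightarrow> heis \<Rightarrow> real \<Rightarrow> bool" where
  "has_horizontal_mean_curvature S p h \<longleftrightarrow>
     (\<exists>W \<nu>\<^sub>1 \<nu>\<^sub>2. open W \<and> p \<in> W \<and> smooth_on W \<nu>\<^sub>1 \<and> smooth_on W \<nu>\<^sub>2 \<and>
        (\<forall>q\<in>W. (\<nu>\<^sub>1 q)\<^sup>2 + (\<nu>\<^sub>2 q)\<^sup>2 = 1) \<and>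
        (\<forall>(U, \<sigma>)\<in>S. \<forall>w\<in>U. \<sigma> w \<in> W \<and> hnormal \<sigma> w \<noteq> 0 \<longrightarrow>
           (\<nu>\<^sub>1 (\<sigma> w), \<nu>\<^sub>2 (\<sigma> w)) = sgn (hnormal \<sigma> w)) \<and>
        h = frechet_derivative \<nu>\<^sub>1 (at p) (XH p) + frechet_derivative \<nu>\<^sub>2 (at p) (YH p))"

definition horizontal_mean_curvature :: "surface \<Rightarrow> heis \<Rightarrow> real" where
  "horizontal_mean_curvature S p = (THE h. has_horizontal_mean_curvature S p h)"

definition zero_horizontal_mean_curvature :: "surface \<Rightarrow> bool" where
  "zero_horizontal_mean_curvature S \<longleftrightarrow>
     (\<forall>p\<in>noncharacteristic_points S. horizontal_mean_curvature S p = 0)"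

section \<open>Local contactomorphisms\<close>

text \<open>
  Smoothness of a map on a (relatively open) subset \<open>M\<close> of a surface is tested in patches.  The
  target is a normed space; for maps into an embedded surface take the ambient \<open>\<real>\<^sup>3\<close>.
\<close>

definition smooth_on_surface :: "surface \<Rightarrow> heis set \<Rightarrow> (heis \<Rightarrow> 'b::real_normed_vector) \<Rightarrow> bool" where
  "smooth_on_surface S M f \<longleftrightarrow> (\<forall>(U, \<sigma>)\<in>S. smooth_on {w\<in>U. \<sigma> w \<in> M} (f \<circ> \<sigma>))"

definition local_diffeo ::
  "surface \<Rightarrow> heis set \<Rightarrow> surface \<Rightarrow> heis set \<Rightarrow> (heis \<Rightarrow> heis) \<Rightarrow> bool" where
  "local_diffeo S M S' M' f \<longleftrightarrow>
     f ` M \<subseteq> M' \<and>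
     (\<forall>p\<in>M. \<exists>P. p \<in> P \<and> openin (top_of_set M) P \<and> openin (top_of_set M') (f ` P) \<and>
        inj_on f P \<and> smooth_on_surface S P f \<and> smooth_on_surface S' (f ` P) (inv_into P f))"

text \<open>
  The equation \<open>f\<^sup>* \<omega>\<^bsub>S'\<^esub> = \<lambda> \<omega>\<^bsub>S\<^esub>\<close> is written in patches: the tangent vectors of \<open>S\<close> at
  \<open>\<sigma> w\<close> are the vectors \<open>D\<sigma>\<^sub>w e\<close>, and \<open>f\<close> maps them to \<open>D(f \<circ> \<sigma>)\<^sub>w e\<close>.
\<close>

definition locally_contactomorphic :: "surface \<Rightarrow> surface \<Rightarrow> bool" where
  "locally_contactomorphic S S' \<longleftrightarrow>
     (\<exists>(f :: heis \<Rightarrow> heis) (l :: heis \<Rightarrow> real).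
        local_diffeo S (noncharacteristic_points S) S' (noncharacteristic_points S') f \<and>
        smooth_on_surface S (noncharacteristic_points S) l \<and>
        (\<forall>(U, \<sigma>)\<in>S. \<forall>w\<in>U. \<sigma> w \<in> noncharacteristic_points S \<longrightarrow>
           (\<forall>e. contact_form (f (\<sigma> w)) (frechet_derivative (f \<circ> \<sigma>) (at w) e) =
                l (\<sigma> w) * contact_form (\<sigma> w) (frechet_derivative \<sigma> (at w) e))))"

definition complex_plane :: surface where
  "complex_plane = {(UNIV, \<lambda>(x, y). (x, y, 0))}"

section \<open>Straight ruled surfaces\<close>

definition ruled_patch ::
  "(real \<Rightarrow> heis) \<Rightarrow> (real \<Rightarrow> real) \<Rightarrow> (real \<Rightarrow> real) \<Rightarrow> real \<times> real \<Rightarrow> heis" where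
  "ruled_patch \<gamma> a b = (\<lambda>(s, v). \<gamma> s + v *\<^sub>R (a s *\<^sub>R XH (\<gamma> s) + b s *\<^sub>R YH (\<gamma> s)))"

text \<open>
  A plane curve is a straight line if it traces a nondegenerate piece of a line; a constant curve
  is not one.  Constant projections must be admitted: a piece of the vertical plane \<open>x = 0\<close> has
  zero horizontal mean curvature and is ruled by horizontal lines, but each curve in it projects
  into the line \<open>x = 0\<close>, so that only a vertical line can serve as \<open>\<gamma>\<close>.
\<close>

definition straight_line_curve :: "real set \<Rightarrow> (real \<Rightarrow> real \<times> real) \<Rightarrow> bool" where
  "straight_line_curve I c \<longleftrightarrow> collinear (c ` I) \<and> \<not> c constant_on I"

text \<open>
  The condition \<open>fst ` D = I\<close> says that the parameter domain \<open>D\<close> contains a piece of the ruling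
  through each \<open>\<gamma> s\<close>; otherwise the condition on the projection of \<open>\<gamma>\<close> could be met by a part of
  the curve that is unrelated to the surface.
\<close>

definition straight_ruled_surface :: "surface \<Rightarrow> bool" where
  "straight_ruled_surface R \<longleftrightarrow>
     (\<exists>I \<gamma> a b D.
        open I \<and> is_interval I \<and> I \<noteq> {} \<and>
        smooth_on I \<gamma> \<and> \<not> straight_line_curve I (prC \<circ> \<gamma>) \<and>
        smooth_on I a \<and> smooth_on I b \<and> (\<forall>s\<in>I. (a s)\<^sup>2 + (b s)\<^sup>2 = 1) \<and>
        open D \<and> connected D \<and> fst ` D = I \<and>
        regular_patch D (ruled_patch \<gamma> a b) \<and>
        R = {(D, ruled_patch \<gamma> a b)})"

end

theory Submission
  imports Defs
begin

text \<open>
  Along a ruling the unit horizontal normal of a ruled surface is constant up to sign, and the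
  horizontal mean curvature is the rate of rotation of that normal along its horizontal tangent; so
  it vanishes.  Both contact forms have the rulings, respectively the rays through the origin, as
  kernel directions, hence any local diffeomorphism that sends rulings to rays is a contactomorphism.

  Conversely, if the mean curvature vanishes then the normal \<open>n\<close> is constant along the horizontal
  tangent field, whose integral curves are thus straight horizontal lines.  This is shown without
  integrating the field: in a graph chart \<open>T\<close> of the surface, with linear left inverse \<open>L\<close>, take the
  horizontal line \<open>l\<close> through a point of the surface with the tangential direction there, and compare
  \<open>l\<close> with \<open>T \<circ> L \<circ> l\<close>.  Gronwall's inequality shows that the two coincide.
\<close>

section \<open>Calculus of smooth maps\<close>

text \<open>Since \<open>L\<close> is linear, it sends the candidate lines to straight segments of
  the parameter plane. The family of lines is therefore explicit and smooth in both parameters, and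
  a planar inverse function theorem shows that the segments fill a neighbourhood; smooth dependence
  of a flow on initial values never enters. The same \<open>L\<close> extends the unit normal to an
  open set of the group, as \<open>n \<circ> L\<close>. This matters because
  \<open>horizontal_mean_curvature\<close> is a definite description: a value has to exist and be
  unique before it can be used. The Gronwall estimate treats position and normal together, because
  the error in the velocity depends on both and neither deviation closes an inequality by itself.
  Two demands shape the end of the proof. The directrix must not trace a piece of a line after
  projection, which is arranged by shearing the parameters along the rulings. And the portion of the
  surface is an arbitrary connected relatively open set, so its parameter domain is in general no
  rectangle.\<close>

lemma frechet_derivative_eqI:
  "(f has_derivative f') (at x) \<Longrightarrow> frechet_derivative f (at x) = f'"
  by (metis frechet_derivative_at)

lemma has_derivative_frechet:
  "f differentiable (at x) \<Longrightarrow> (f has_derivative frechet_derivative f (at x)) (at x)"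
  by (simp add: frechet_derivative_works)

lemma has_derivative_cong_open:
  assumes "open S" "x \<in> S" "\<And>y. y \<in> S \<Longrightarrow> f y = g y"
  shows "(f has_derivative f') (at x) \<longleftrightarrow> (g has_derivative f') (at x)"
  using assms by (metis has_derivative_transform_within_open)

text \<open>Also valid where neither map is differentiable: \<open>frechet_derivative\<close> is a
  choice from the predicate \<open>has_derivative\<close>, and the two predicates coincide.\<close>

lemma frechet_derivative_cong_open:
  assumes "open S" "x \<in> S" "\<And>y. y \<in> S \<Longrightarrow> f y = g y"
  shows "frechet_derivative f (at x) = frechet_derivative g (at x)"
  using has_derivative_cong_open[OF assms] by (simp add: frechet_derivative_def)

lemma differentiable_cong_open:
  assumes "open S" "x \<in> S" "\<And>y. y \<in> S \<Longrightarrow> f y = g y"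
  shows "f differentiable (at x) \<longleftrightarrow> g differentiable (at x)"
  using has_derivative_cong_open[OF assms] by (simp add: differentiable_def)

section \<open>Closure properties of finite differentiability classes\<close>

lemma Ck_on_cong:
  assumes "open S" "\<And>x. x \<in> S \<Longrightarrow> f x = g x"
  shows "Ck_on k S f \<longleftrightarrow> Ck_on k S g"
  using assms(2)
proof (induction k arbitrary: f g)
  case 0
  then show ?case by (simp cong: continuous_on_cong)
next
  case (Suc k)
  have "(\<forall>x\<in>S. f differentiable (at x)) \<longleftrightarrow> (\<forall>x\<in>S. g differentiable (at x))"
    using differentiable_cong_open[OF assms(1)] Suc.prems by blast
  moreover have "Ck_on k S (\<lambda>x. frechet_derivative f (at x) v) \<longleftrightarrow>
      Ck_on k S (\<lambda>x. frechet_derivative g (at x) v)" for v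
    using frechet_derivative_cong_open[where f=f and g=g, OF assms(1) _ Suc.prems]
    by (intro Suc.IH) simp
  ultimately show ?case by simp
qed

text \<open>The inductive step of most closure rules below: on an open set any formula
  \<open>F\<close> for the derivative may replace the chosen
  \<open>frechet_derivative\<close>.\<close>

lemma Ck_on_SucI:
  assumes "open S" "\<And>x. x \<in> S \<Longrightarrow> (f has_derivative F x) (at x)"
    and "\<And>v. Ck_on k S (\<lambda>x. F x v)"
  shows "Ck_on (Suc k) S f"
proof -
  have "Ck_on k S (\<lambda>x. frechet_derivative f (at x) v)" for v
    using Ck_on_cong[OF assms(1), of "\<lambda>x. frechet_derivative f (at x) v" "\<lambda>x. F x v" k]
      frechet_derivative_eqI[OF assms(2)] assms(3) by simp
  then show ?thesis using assms(2) by (auto simp: differentiable_def)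
qed

lemma Ck_on_Suc_has_derivative:
  "Ck_on (Suc k) S f \<Longrightarrow> x \<in> S \<Longrightarrow> (f has_derivative frechet_derivative f (at x)) (at x)"
  by (simp add: has_derivative_frechet)

lemma Ck_on_Suc_D: "Ck_on (Suc k) S f \<Longrightarrow> Ck_on k S f"
proof (induction k arbitrary: f)
  case 0
  then show ?case
    by (simp add: continuous_at_imp_continuous_on differentiable_imp_continuous_within)
qed auto

lemma Ck_on_imp_continuous_on: "Ck_on k S f \<Longrightarrow> continuous_on S f"
  by (induction k) (auto simp del: Ck_on.simps(2) dest: Ck_on_Suc_D)

lemma Ck_on_subset: "Ck_on k S f \<Longrightarrow> T \<subseteq> S \<Longrightarrow> Ck_on k T f"
  by (induction k arbitrary: f) (auto intro: continuous_on_subset)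

lemma Ck_on_const: "open S \<Longrightarrow> Ck_on k S (\<lambda>x. c)"
  by (induction k arbitrary: c) auto

lemma Ck_on_bounded_linear: "open S \<Longrightarrow> bounded_linear h \<Longrightarrow> Ck_on k S h"
proof (cases k)
  case 0
  then show "bounded_linear h \<Longrightarrow> ?thesis"
    by (simp add: linear_continuous_on)
next
  case (Suc l)
  assume "open S" "bounded_linear h"
  then show ?thesis unfolding Suc
    by (intro Ck_on_SucI[where F="\<lambda>_. h"] bounded_linear_imp_has_derivative Ck_on_const)
qed

lemma Ck_on_bounded_linear_compose:
  assumes "open S" "bounded_linear h" "Ck_on k S f"
  shows "Ck_on k S (\<lambda>x. h (f x))"
  using assms(3)
proof (induction k arbitrary: f)
  case 0
  then show ?case
    using assms(2) by (auto intro: continuous_on_compose2[OF linear_continuous_on])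
next
  case (Suc k)
  show ?case
    by (rule Ck_on_SucI[OF assms(1) bounded_linear.has_derivative[OF assms(2) Ck_on_Suc_has_derivative[OF Suc.prems]]])
      (use Suc in auto)
qed

lemma Ck_on_add:
  assumes "open S" "Ck_on k S f" "Ck_on k S g"
  shows "Ck_on k S (\<lambda>x. f x + g x)"
  using assms(2,3)
proof (induction k arbitrary: f g)
  case 0
  then show ?case by (auto intro: continuous_intros)
next
  case (Suc k)
  show ?case
    by (rule Ck_on_SucI[OF assms(1) has_derivative_add[OF
            Ck_on_Suc_has_derivative[OF Suc.prems(1)] Ck_on_Suc_has_derivative[OF Suc.prems(2)]]])
      (use Suc in auto)
qed

text \<open>The Leibniz rule yields two terms of the same shape, each with one factor differentiated
  and the other lowered by \<open>Ck_on_Suc_D\<close>, so the induction hypothesis applies to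
  both.\<close>

lemma Ck_on_bilinear:
  assumes "open S" "bounded_bilinear m" "Ck_on k S f" "Ck_on k S g"
  shows "Ck_on k S (\<lambda>x. m (f x) (g x))"
  using assms(3,4)
proof (induction k arbitrary: f g)
  case 0
  then show ?case using assms(2) by (auto intro: bounded_bilinear.continuous_on)
next
  case (Suc k)
  note fg = Ck_on_Suc_D[OF Suc.prems(1)] Ck_on_Suc_D[OF Suc.prems(2)]
  show ?case
    by (rule Ck_on_SucI[OF assms(1) bounded_bilinear.FDERIV[OF assms(2)
            Ck_on_Suc_has_derivative[OF Suc.prems(1)] Ck_on_Suc_has_derivative[OF Suc.prems(2)]]])
      (use Suc fg in \<open>auto intro!: Ck_on_add[OF assms(1)]\<close>)
qed

lemma Ck_on_sum:
  assumes "open S" "\<And>i. i \<in> I \<Longrightarrow> Ck_on k S (f i)"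
  shows "Ck_on k S (\<lambda>x. \<Sum>i\<in>I. f i x)"
  using assms(2)
  by (induction I rule: infinite_finite_induct) (auto intro: Ck_on_const Ck_on_add assms(1))

text \<open>In the chain rule the outer derivative is taken in the direction \<open>?f' x v\<close>,
  which varies with \<open>x\<close>, while \<open>Ck_on\<close> speaks of fixed directions.
  Expanding this direction in the basis of the Euclidean middle space moves the dependence on
  \<open>x\<close> into scalar coefficients.\<close>

lemma Ck_on_compose:
  fixes f :: "'a::real_normed_vector \<Rightarrow> 'b::euclidean_space" and g :: "'b \<Rightarrow> 'c::real_normed_vector"
  assumes "open S" "open T" "Ck_on k S f" "Ck_on k T g" "f ` S \<subseteq> T"
  shows "Ck_on k S (\<lambda>x. g (f x))"
  using assms(3-5)
proof (induction k arbitrary: g)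
  case 0
  then show ?case by (auto intro: continuous_on_compose2)
next
  case (Suc k)
  let ?f' = "\<lambda>x. frechet_derivative f (at x)" and ?g' = "\<lambda>x. frechet_derivative g (at x)"
  have f': "(f has_derivative ?f' x) (at x)" if "x \<in> S" for x
    using that Suc.prems(1) by (simp add: has_derivative_frechet)
  have g': "(g has_derivative ?g' (f x)) (at (f x))" if "x \<in> S" for x
    using that Suc.prems by (intro has_derivative_frechet) auto
  have expand: "?g' (f x) (?f' x v) = (\<Sum>b\<in>Basis. (?f' x v \<bullet> b) *\<^sub>R ?g' (f x) b)"
    if "x \<in> S" for x v
  proof -
    have "linear (?g' (f x))"
      using has_derivative_bounded_linear[OF g'[OF that]] bounded_linear.linear by blast
    then have "?g' (f x) (\<Sum>b\<in>Basis. (?f' x v \<bullet> b) *\<^sub>R b) =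
        (\<Sum>b\<in>Basis. (?f' x v \<bullet> b) *\<^sub>R ?g' (f x) b)"
      by (simp add: linear_sum linear_scale)
    then show ?thesis by (simp add: euclidean_representation)
  qed
  show ?case
  proof (rule Ck_on_SucI[OF assms(1)])
    show "((\<lambda>x. g (f x)) has_derivative
        (\<lambda>v. \<Sum>b\<in>Basis. (?f' x v \<bullet> b) *\<^sub>R ?g' (f x) b)) (at x)" if "x \<in> S" for x
      using has_derivative_compose[OF f' g'] that expand by auto
    show "Ck_on k S (\<lambda>x. \<Sum>b\<in>Basis. (?f' x v \<bullet> b) *\<^sub>R ?g' (f x) b)" for v
      using Suc.prems Ck_on_Suc_D[OF Suc.prems(1)]
      by (intro Ck_on_sum Ck_on_bilinear[OF _ bounded_bilinear_scaleR] assms(1)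
          Ck_on_bounded_linear_compose[OF _ bounded_linear_inner_left] Suc.IH) auto
  qed
qed

text \<open>\<open>\<phi>'\<close> is a function of \<open>x\<close>, not of \<open>f x\<close>, so
  that it can be written through \<open>\<phi> (f x)\<close> itself. For the inverse, the square
  root and the exponential, the regularity then raises itself by induction.\<close>

lemma Ck_on_chain:
  fixes f :: "'a::real_normed_vector \<Rightarrow> real"
  assumes "open S" "Ck_on (Suc k) S f" "\<And>x. x \<in> S \<Longrightarrow> (\<phi> has_real_derivative \<phi>' x) (at (f x))"
    and "Ck_on k S \<phi>'"
  shows "Ck_on (Suc k) S (\<lambda>x. \<phi> (f x))"
proof (rule Ck_on_SucI[OF assms(1)])
  show "((\<lambda>x. \<phi> (f x)) has_derivative (\<lambda>v. \<phi>' x * frechet_derivative f (at x) v)) (at x)"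
    if "x \<in> S" for x
    using has_derivative_compose[OF Ck_on_Suc_has_derivative[OF assms(2) that]
        assms(3)[OF that, unfolded has_field_derivative_def]] by simp
  show "Ck_on k S (\<lambda>x. \<phi>' x * frechet_derivative f (at x) v)" for v
    using assms by (auto intro!: Ck_on_bilinear[OF _ bounded_bilinear_mult])
qed

lemma Ck_on_inverse:
  fixes f :: "'a::real_normed_vector \<Rightarrow> real"
  assumes "open S" "Ck_on k S f" "\<And>x. x \<in> S \<Longrightarrow> f x \<noteq> 0"
  shows "Ck_on k S (\<lambda>x. inverse (f x))"
  using assms(2)
proof (induction k)
  case 0
  then show ?case using assms(3) by (auto intro: continuous_intros)
next
  case (Suc k)
  note IH = Suc.IH[OF Ck_on_Suc_D[OF Suc.prems]]
  have "((inverse :: real \<Rightarrow> real) has_real_derivative (- 1) * (inverse (f x) * inverse (f x))) (at (f x))"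
    if "x \<in> S" for x
    using DERIV_inverse[OF assms(3)[OF that]] by (simp add: power2_eq_square)
  moreover have "Ck_on k S (\<lambda>x. (- 1) * (inverse (f x) * inverse (f x)))"
    by (intro Ck_on_bilinear[OF _ bounded_bilinear_mult] Ck_on_const assms(1) IH)
  ultimately show ?case
    by (rule Ck_on_chain[OF assms(1) Suc.prems])
qed

lemma Ck_on_sqrt:
  fixes f :: "'a::real_normed_vector \<Rightarrow> real"
  assumes "open S" "Ck_on k S f" "\<And>x. x \<in> S \<Longrightarrow> f x > 0"
  shows "Ck_on k S (\<lambda>x. sqrt (f x))"
  using assms(2)
proof (induction k)
  case 0
  then show ?case by (auto intro: continuous_intros)
next
  case (Suc k)
  note IH = Suc.IH[OF Ck_on_Suc_D[OF Suc.prems]]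
  have "Ck_on k S (\<lambda>x. inverse (sqrt (f x)) * (1 / 2))"
    using IH assms(3)
    by (intro Ck_on_bilinear[OF _ bounded_bilinear_mult] Ck_on_inverse Ck_on_const assms(1)) force+
  then show ?case
    using Ck_on_chain[OF assms(1) Suc.prems DERIV_real_sqrt[OF assms(3)]] by simp
qed

lemma Ck_on_exp:
  fixes f :: "'a::real_normed_vector \<Rightarrow> real"
  assumes "open S" "Ck_on k S f"
  shows "Ck_on k S (\<lambda>x. exp (f x))"
  using assms(2)
proof (induction k)
  case 0
  then show ?case by (auto intro: continuous_intros)
next
  case (Suc k)
  show ?case
    by (rule Ck_on_chain[OF assms(1) Suc.prems DERIV_exp Suc.IH[OF Ck_on_Suc_D[OF Suc.prems]]])
qed

text \<open>Each of the two functions is, up to sign, the derivative of the other, so the induction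
  carries both.\<close>

lemma Ck_on_sin_cos:
  fixes f :: "'a::real_normed_vector \<Rightarrow> real"
  assumes "open S" "Ck_on k S f"
  shows "Ck_on k S (\<lambda>x. sin (f x)) \<and> Ck_on k S (\<lambda>x. cos (f x))"
  using assms(2)
proof (induction k)
  case 0
  then show ?case by (auto intro: continuous_intros)
next
  case (Suc k)
  note IH = Suc.IH[OF Ck_on_Suc_D[OF Suc.prems]]
  have "Ck_on k S (\<lambda>x. - sin (f x))"
    using IH assms(1) Ck_on_bounded_linear_compose[OF _ bounded_linear_minus[OF bounded_linear_ident]]
    by blast
  then show ?case
    using Ck_on_chain[OF assms(1) Suc.prems DERIV_sin] Ck_on_chain[OF assms(1) Suc.prems DERIV_cos] IH
    by blast
qed

section \<open>Closure properties of smooth maps\<close>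

lemma smooth_on_cong:
  assumes "open S" "\<And>x. x \<in> S \<Longrightarrow> f x = g x"
  shows "smooth_on S f \<longleftrightarrow> smooth_on S g"
  using Ck_on_cong[OF assms] by (simp add: smooth_on_def)

lemma smooth_on_subset: "smooth_on S f \<Longrightarrow> T \<subseteq> S \<Longrightarrow> smooth_on T f"
  by (auto simp: smooth_on_def intro: Ck_on_subset)

lemma smooth_on_imp_continuous_on: "smooth_on S f \<Longrightarrow> continuous_on S f"
  by (auto simp: smooth_on_def intro: Ck_on_imp_continuous_on)

lemma smooth_on_has_derivative:
  "smooth_on S f \<Longrightarrow> x \<in> S \<Longrightarrow> (f has_derivative frechet_derivative f (at x)) (at x)"
  unfolding smooth_on_def using Ck_on_Suc_has_derivative by blast

lemma smooth_on_frechet_derivative: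
  "smooth_on S f \<Longrightarrow> smooth_on S (\<lambda>x. frechet_derivative f (at x) v)"
  unfolding smooth_on_def by (metis Ck_on.simps(2))

lemma smooth_on_const: "open S \<Longrightarrow> smooth_on S (\<lambda>x. c)"
  by (simp add: smooth_on_def Ck_on_const)

lemma smooth_on_bounded_linear: "open S \<Longrightarrow> bounded_linear h \<Longrightarrow> smooth_on S h"
  by (simp add: smooth_on_def Ck_on_bounded_linear)

lemma smooth_on_bounded_linear_compose:
  "open S \<Longrightarrow> bounded_linear h \<Longrightarrow> smooth_on S f \<Longrightarrow> smooth_on S (\<lambda>x. h (f x))"
  by (simp add: smooth_on_def Ck_on_bounded_linear_compose)

lemma smooth_on_ident: "open S \<Longrightarrow> smooth_on S (\<lambda>x. x)"
  by (simp add: smooth_on_bounded_linear bounded_linear_ident)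

lemma smooth_on_add:
  "open S \<Longrightarrow> smooth_on S f \<Longrightarrow> smooth_on S g \<Longrightarrow> smooth_on S (\<lambda>x. f x + g x)"
  by (simp add: smooth_on_def Ck_on_add)

lemma smooth_on_minus: "open S \<Longrightarrow> smooth_on S f \<Longrightarrow> smooth_on S (\<lambda>x. - f x)"
  by (rule smooth_on_bounded_linear_compose[OF _ bounded_linear_minus[OF bounded_linear_ident]])

lemma smooth_on_diff:
  "open S \<Longrightarrow> smooth_on S f \<Longrightarrow> smooth_on S g \<Longrightarrow> smooth_on S (\<lambda>x. f x - g x)"
  using smooth_on_add[OF _ _ smooth_on_minus] by fastforce

lemma smooth_on_scaleR:
  "open S \<Longrightarrow> smooth_on S f \<Longrightarrow> smooth_on S g \<Longrightarrow> smooth_on S (\<lambda>x. f x *\<^sub>R g x)"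
  by (simp add: smooth_on_def Ck_on_bilinear[OF _ bounded_bilinear_scaleR])

lemma smooth_on_mult:
  fixes f g :: "'a::real_normed_vector \<Rightarrow> real"
  shows "open S \<Longrightarrow> smooth_on S f \<Longrightarrow> smooth_on S g \<Longrightarrow> smooth_on S (\<lambda>x. f x * g x)"
  by (simp add: smooth_on_def Ck_on_bilinear[OF _ bounded_bilinear_mult])

lemma smooth_on_power2:
  fixes f :: "'a::real_normed_vector \<Rightarrow> real"
  shows "open S \<Longrightarrow> smooth_on S f \<Longrightarrow> smooth_on S (\<lambda>x. (f x)\<^sup>2)"
  by (simp add: power2_eq_square smooth_on_mult)

lemma smooth_on_inverse:
  fixes f :: "'a::real_normed_vector \<Rightarrow> real"
  shows "open S \<Longrightarrow> smooth_on S f \<Longrightarrow> (\<And>x. x \<in> S \<Longrightarrow> f x \<noteq> 0) \<Longrightarrow> smooth_on S (\<lambda>x. inverse (f x))"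
  by (simp add: smooth_on_def Ck_on_inverse)

lemma smooth_on_divide:
  fixes f g :: "'a::real_normed_vector \<Rightarrow> real"
  shows "open S \<Longrightarrow> smooth_on S f \<Longrightarrow> smooth_on S g \<Longrightarrow> (\<And>x. x \<in> S \<Longrightarrow> g x \<noteq> 0) \<Longrightarrow>
    smooth_on S (\<lambda>x. f x / g x)"
  unfolding divide_inverse by (intro smooth_on_mult smooth_on_inverse)

lemma smooth_on_sqrt:
  fixes f :: "'a::real_normed_vector \<Rightarrow> real"
  shows "open S \<Longrightarrow> smooth_on S f \<Longrightarrow> (\<And>x. x \<in> S \<Longrightarrow> f x > 0) \<Longrightarrow> smooth_on S (\<lambda>x. sqrt (f x))"
  by (simp add: smooth_on_def Ck_on_sqrt)

lemma smooth_on_exp: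
  fixes f :: "'a::real_normed_vector \<Rightarrow> real"
  shows "open S \<Longrightarrow> smooth_on S f \<Longrightarrow> smooth_on S (\<lambda>x. exp (f x))"
  by (simp add: smooth_on_def Ck_on_exp)

lemma smooth_on_sin:
  fixes f :: "'a::real_normed_vector \<Rightarrow> real"
  shows "open S \<Longrightarrow> smooth_on S f \<Longrightarrow> smooth_on S (\<lambda>x. sin (f x))"
  by (simp add: smooth_on_def Ck_on_sin_cos)

lemma smooth_on_cos:
  fixes f :: "'a::real_normed_vector \<Rightarrow> real"
  shows "open S \<Longrightarrow> smooth_on S f \<Longrightarrow> smooth_on S (\<lambda>x. cos (f x))"
  by (simp add: smooth_on_def Ck_on_sin_cos)

lemma smooth_on_fst: "open S \<Longrightarrow> smooth_on S f \<Longrightarrow> smooth_on S (\<lambda>x. fst (f x))"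
  by (rule smooth_on_bounded_linear_compose[OF _ bounded_linear_fst])

lemma smooth_on_snd: "open S \<Longrightarrow> smooth_on S f \<Longrightarrow> smooth_on S (\<lambda>x. snd (f x))"
  by (rule smooth_on_bounded_linear_compose[OF _ bounded_linear_snd])

lemma smooth_on_Pair:
  assumes "open S" "smooth_on S f" "smooth_on S g"
  shows "smooth_on S (\<lambda>x. (f x, g x))"
proof -
  have "smooth_on S (\<lambda>x. (f x, 0) + (0, g x))"
    using assms
    by (intro smooth_on_add smooth_on_bounded_linear_compose[where h="\<lambda>a. (a, 0)"]
        smooth_on_bounded_linear_compose[where h="\<lambda>a. (0, a)"])
      (auto intro: bounded_linear_Pair bounded_linear_ident bounded_linear_zero)
  then show ?thesis by simp
qed

lemma smooth_on_compose:
  fixes f :: "'a::real_normed_vector \<Rightarrow> 'b::euclidean_space" and g :: "'b \<Rightarrow> 'c::real_normed_vector"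
  assumes "open S" "open T" "smooth_on S f" "smooth_on T g" "f ` S \<subseteq> T"
  shows "smooth_on S (\<lambda>x. g (f x))"
  using assms Ck_on_compose unfolding smooth_on_def by blast

lemmas smooth_on_intros = smooth_on_const smooth_on_ident smooth_on_add smooth_on_minus
  smooth_on_diff smooth_on_scaleR smooth_on_mult smooth_on_power2 smooth_on_fst smooth_on_snd
  smooth_on_Pair smooth_on_exp smooth_on_sin smooth_on_cos

section \<open>The inverse function theorem in the plane\<close>

lemma linear_pair:
  fixes f :: "real \<times> real \<Rightarrow> 'a::real_vector"
  assumes "linear f"
  shows "f v = fst v *\<^sub>R f (1, 0) + snd v *\<^sub>R f (0, 1)"
proof -
  have "v = fst v *\<^sub>R (1, 0) + snd v *\<^sub>R (0, 1)" by (simp add: prod_eq_iff)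
  then show ?thesis using assms by (metis linear_add linear_scale)
qed

text \<open>If the determinant vanishes, the coefficient vectors built from the entries of the
  columns lie in the kernel, so injectivity makes all of them zero. The image of
  \<open>(1, 0)\<close> is then zero as well, a contradiction.\<close>

lemma inj_linear_imp_det_nonzero:
  fixes f :: "real \<times> real \<Rightarrow> real \<times> real"
  assumes "linear f" "inj f"
  shows "fst (f (1, 0)) * snd (f (0, 1)) - snd (f (1, 0)) * fst (f (0, 1)) \<noteq> 0"
proof
  let ?a = "f (1, 0)" and ?b = "f (0, 1)"
  assume J: "fst ?a * snd ?b - snd ?a * fst ?b = 0"
  have zero: "v = 0" if "f v = 0" for v
    using assms that by (metis injD linear_0)
  have "f (snd ?b, - snd ?a) = 0" "f (fst ?b, - fst ?a) = 0"
    using J linear_pair[OF assms(1), of "(snd ?b, - snd ?a)"]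
      linear_pair[OF assms(1), of "(fst ?b, - fst ?a)"]
    by (auto simp: prod_eq_iff algebra_simps)
  then have "(snd ?b, - snd ?a) = 0" "(fst ?b, - fst ?a) = 0"
    using zero by blast+
  then have "?a = 0" by (auto simp: prod_eq_iff)
  then show False using zero[of "(1, 0)"] by (simp add: prod_eq_iff)
qed

text \<open>The classical theorem provides a differentiable inverse whose derivative at
  \<open>y\<close> inverts that of \<open>f\<close> at \<open>g y\<close>. Cramer's rule writes this
  as a smooth function of \<open>g y\<close>, so each degree of regularity of \<open>g\<close>
  yields the next.\<close>

lemma smooth_inverse_function:
  fixes f :: "real \<times> real \<Rightarrow> real \<times> real"
  assumes U: "open U" "smooth_on U f" "w0 \<in> U" and inj: "inj (frechet_derivative f (at w0))"
  obtains A B g where "open A" "A \<subseteq> U" "w0 \<in> A" "open B" "f w0 \<in> B" "homeomorphism A B f g"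
    "smooth_on B g" "\<And>w. w \<in> A \<Longrightarrow> inj (frechet_derivative f (at w))"
proof -
  let ?D = "\<lambda>x. frechet_derivative f (at x)"
  let ?F = "\<lambda>x. Blinfun (?D x)"
  have bl: "bounded_linear (?D x)" if "x \<in> U" for x
    using smooth_on_has_derivative[OF U(2) that] has_derivative_bounded_linear by blast
  then have app: "blinfun_apply (?F x) = ?D x" if "x \<in> U" for x
    using that by (simp add: bounded_linear_Blinfun_apply)
  have 1: "(f has_derivative blinfun_apply (?F x)) (at x)" if "x \<in> U" for x
    using smooth_on_has_derivative[OF U(2) that] app that by simp
  have 2: "continuous_on U ?F"
  proof (rule continuous_on_blinfun_componentwise)
    show "continuous_on U (\<lambda>x. blinfun_apply (?F x) i)" for i
      using smooth_on_imp_continuous_on[OF smooth_on_frechet_derivative[OF U(2), of i]]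
      by (simp add: app cong: continuous_on_cong)
  qed
  obtain h where h: "linear h" "h \<circ> ?D w0 = id"
    using linear_injective_left_inverse[OF bounded_linear.linear[OF bl[OF U(3)]] inj] by blast
  have 3: "Blinfun h o\<^sub>L ?F w0 = id_blinfun"
    using h app[OF U(3)] by (intro blinfun_eqI)
      (auto simp: bounded_linear_Blinfun_apply linear_conv_bounded_linear dest: fun_cong)
  obtain A B g g' where AB: "open A" "A \<subseteq> U" "w0 \<in> A" "open B" "f w0 \<in> B" and
      hom: "homeomorphism A B f g" and
      g': "\<And>y. y \<in> B \<Longrightarrow> (g has_derivative (g' y)) (at y)" and
      inv: "\<And>y. y \<in> B \<Longrightarrow> g' y = inv (blinfun_apply (?F (g y)))" and
      bij: "\<And>y. y \<in> B \<Longrightarrow> bij (blinfun_apply (?F (g y)))"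
    using inverse_function_theorem[OF U(1) 1 2 U(3) 3] by metis
  have gA: "g y \<in> A" if "y \<in> B" for y
    using hom that by (auto simp: homeomorphism_def)
  have injA: "inj (?D w)" if "w \<in> A" for w
  proof -
    have "f w \<in> B" "g (f w) = w" using hom that by (auto simp: homeomorphism_def)
    then show ?thesis using bij[of "f w"] app[of w] AB(2) that by (auto simp: bij_is_inj)
  qed
  define a where "a = (\<lambda>x. ?D x (1, 0))"
  define b where "b = (\<lambda>x. ?D x (0, 1))"
  define J where "J = (\<lambda>x. fst (a x) * snd (b x) - snd (a x) * fst (b x))"
  have J: "J x \<noteq> 0" if "x \<in> A" for x
    unfolding J_def a_def b_def using that AB(2)
    by (intro inj_linear_imp_det_nonzero injA bounded_linear.linear bl) auto
  \<comment> \<open>Cramer's rule: the coordinates of \<open>v\<close> with respect to the columns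
    \<open>a x\<close> and \<open>b x\<close> of the differential.\<close>
  define M where "M = (\<lambda>v x. (inverse (J x) * (fst v * snd (b x) - snd v * fst (b x)),
     inverse (J x) * (fst (a x) * snd v - snd (a x) * fst v)))"
  have smooth_ab: "smooth_on A a" "smooth_on A b"
    using smooth_on_frechet_derivative[OF smooth_on_subset[OF U(2) AB(2)]]
    by (auto simp: a_def b_def)
  have smooth_J: "smooth_on A J"
    unfolding J_def by (intro smooth_on_intros smooth_ab AB(1))
  then have smooth_M: "smooth_on A (M v)" for v
    unfolding M_def by (intro smooth_on_intros smooth_on_inverse smooth_ab AB(1) J)
  have g'M: "g' y v = M v (g y)" if "y \<in> B" for y v
  proof -
    have x: "g y \<in> A" "g y \<in> U" using gA[OF that] AB(2) by auto
    have J0: "J (g y) \<noteq> 0" using J x by blast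
    have "?D (g y) (M v (g y)) = fst (M v (g y)) *\<^sub>R a (g y) + snd (M v (g y)) *\<^sub>R b (g y)"
      unfolding a_def b_def by (rule linear_pair[OF bounded_linear.linear[OF bl[OF x(2)]]])
    also have "\<dots> = v"
    proof -
      have "fst v * (J (g y) * inverse (J (g y))) = fst v" "snd v * (J (g y) * inverse (J (g y))) = snd v"
        using J0 by auto
      then show ?thesis
        by (auto simp: M_def prod_eq_iff J_def algebra_simps)
    qed
    finally have "inv (?D (g y)) v = M v (g y)"
      using injA[OF x(1)] by (metis inv_f_f)
    then show ?thesis using inv[OF that] app[OF x(2)] by simp
  qed
  \<comment> \<open>Bootstrapping: if \<open>g\<close> has class \<open>k\<close>, so has
    \<open>M v (g y)\<close>, which is the derivative of \<open>g\<close> in direction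
    \<open>v\<close>.\<close>
  have "Ck_on k B g" for k
  proof (induction k)
    case 0
    then show ?case using hom by (simp add: homeomorphism_def)
  next
    case (Suc k)
    show ?case
    proof (rule Ck_on_SucI[OF AB(4) g'])
      fix v
      have "Ck_on k B (\<lambda>y. M v (g y))"
        using smooth_M gA by (intro Ck_on_compose[OF AB(4) AB(1) Suc]) (auto simp: smooth_on_def)
      then show "Ck_on k B (\<lambda>y. g' y v)"
        using Ck_on_cong[OF AB(4), of "\<lambda>y. g' y v" "\<lambda>y. M v (g y)" k] g'M by simp
    qed
  qed
  then have "smooth_on B g" by (simp add: smooth_on_def)
  with AB hom injA that show thesis by blast
qed

section \<open>Horizontal normals of patches\<close>

lemma frechet_derivative_bounded_linear_compose:
  assumes "bounded_linear h" "f differentiable (at x)"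
  shows "frechet_derivative (h \<circ> f) (at x) = h \<circ> frechet_derivative f (at x)"
  using bounded_linear.has_derivative[OF assms(1) has_derivative_frechet[OF assms(2)]]
  by (auto intro!: frechet_derivative_eqI simp: o_def)

lemma smooth_on_differentiable: "smooth_on S f \<Longrightarrow> x \<in> S \<Longrightarrow> f differentiable (at x)"
  using smooth_on_has_derivative differentiable_def by blast

lemma smooth_on_linear_frechet_derivative:
  "smooth_on S f \<Longrightarrow> x \<in> S \<Longrightarrow> linear (frechet_derivative f (at x))"
  using smooth_on_differentiable linear_frechet_derivative by blast

lemma open_Int_vimage:
  "continuous_on S f \<Longrightarrow> open S \<Longrightarrow> open T \<Longrightarrow> open {x \<in> S. f x \<in> T}"
  using continuous_open_preimage[of S f T] by (simp add: vimage_def Int_def)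

text \<open>A nonzero kernel vector is a linear relation between the two columns, so the range is
  spanned by one of them.\<close>

lemma inj_linear_if_dim_range:
  fixes f :: "real \<times> real \<Rightarrow> 'a::euclidean_space"
  assumes lin: "linear f" and dim: "dim (range f) = 2"
  shows "inj f"
proof (rule ccontr)
  assume "\<not> inj f"
  then obtain v where v: "f v = 0" "v \<noteq> 0"
    using linear_injective_0[OF lin] by blast
  note f = linear_pair[OF lin]
  have "\<exists>c. range f \<subseteq> span {c}"
  proof (cases "fst v = 0")
    case True
    then have "snd v \<noteq> 0" using v(2) by (auto simp: prod_eq_iff)
    then have "f (0, 1) = 0" using f[of v] v(1) True by simp
    then have "\<exists>k. f w = k *\<^sub>R f (1, 0)" for w
      using f[of w] by auto
    then have "range f \<subseteq> span {f (1, 0)}"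
      unfolding span_singleton by blast
    then show ?thesis by blast
  next
    case False
    have "fst v *\<^sub>R f (1, 0) = - snd v *\<^sub>R f (0, 1)"
      using f[of v] v(1) by (simp add: eq_neg_iff_add_eq_0)
    then have "f (1, 0) = (inverse (fst v) * - snd v) *\<^sub>R f (0, 1)"
      using False by (metis scaleR_scaleR left_inverse scaleR_one)
    then have "f w = (fst w * (inverse (fst v) * - snd v) + snd w) *\<^sub>R f (0, 1)" for w
      using f[of w] by (simp add: scaleR_left_diff_distrib)
    then have "\<exists>k. f w = k *\<^sub>R f (0, 1)" for w by blast
    then have "range f \<subseteq> span {f (0, 1)}"
      unfolding span_singleton by blast
    then show ?thesis by blast
  qed
  then obtain c where "range f \<subseteq> span {c}" by blast
  then have "dim (range f) \<le> card {c}" by (intro dim_le_card) auto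
  then show False using dim by simp
qed

lemma regular_patch_inj:
  assumes "regular_patch U \<sigma>" "w \<in> U"
  shows "inj (frechet_derivative \<sigma> (at w))"
  using assms smooth_on_linear_frechet_derivative
  unfolding regular_patch_def by (intro inj_linear_if_dim_range) blast+

text \<open>A differentiable left inverse gives both remaining conditions at once: its continuity
  makes the patch a homeomorphism onto its image, and the chain rule for
  \<open>g \<circ> \<sigma>\<close> makes the differential injective.\<close>

lemma regular_patchI:
  assumes "open U" "smooth_on U \<sigma>"
    and inv: "\<And>w. w \<in> U \<Longrightarrow> g (\<sigma> w) = w" "\<And>w. w \<in> U \<Longrightarrow> g differentiable (at (\<sigma> w))"
  shows "regular_patch U \<sigma>"
  unfolding regular_patch_def
proof (intro conjI ballI exI)
  show "homeomorphism U (\<sigma> ` U) \<sigma> g"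
    unfolding homeomorphism_def
  proof (intro conjI)
    show "continuous_on U \<sigma>" by (rule smooth_on_imp_continuous_on[OF assms(2)])
    show "continuous_on (\<sigma> ` U) g"
      using inv by (auto intro!: continuous_at_imp_continuous_on differentiable_imp_continuous_within)
    show "g ` \<sigma> ` U = U" using inv(1) by force
  qed (use inv(1) in auto)
  show "dim (range (frechet_derivative \<sigma> (at w))) = 2" if "w \<in> U" for w
  proof -
    let ?D = "frechet_derivative \<sigma> (at w)"
    have "(id has_derivative (frechet_derivative g (at (\<sigma> w)) \<circ> ?D)) (at w)"
    proof (rule has_derivative_transform_within_open[OF _ assms(1) that])
      show "(g \<circ> \<sigma> has_derivative (frechet_derivative g (at (\<sigma> w)) \<circ> ?D)) (at w)"
        using diff_chain_at[OF smooth_on_has_derivative[OF assms(2) that]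
            has_derivative_frechet[OF inv(2)[OF that]]] .
    qed (use inv in auto)
    then have "frechet_derivative g (at (\<sigma> w)) \<circ> ?D = id"
      using has_derivative_unique has_derivative_id by blast
    then have "inj ?D" by (metis inj_on_id inj_on_imageI2)
    then have "dim (range ?D) = dim (UNIV :: (real \<times> real) set)"
      using smooth_on_linear_frechet_derivative[OF assms(2) that]
      by (intro dim_image_eq) (auto simp: inj_on_subset)
    then show ?thesis by simp
  qed
qed (use assms in auto)

section \<open>The horizontal normal expressed through the contact form\<close>

lemma bounded_linear_coords: "bounded_linear xc" "bounded_linear yc" "bounded_linear tc"
  unfolding xc_def yc_def tc_def
  by (auto intro: bounded_linear_fst bounded_linear_snd bounded_linear_compose[OF bounded_linear_fst]
      bounded_linear_compose[OF bounded_linear_snd])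

text \<open>The normal with components \<open>n\<close> turned by a quarter turn inside the
  horizontal plane. The point \<open>q\<close> is a separate argument because the same components
  are later read at different points of a line.\<close>

definition horizontal_tangent :: "real \<times> real \<Rightarrow> heis \<Rightarrow> heis" where
  "horizontal_tangent n q = snd n *\<^sub>R XH q - fst n *\<^sub>R YH q"

lemma horizontal_tangent_eq:
  "horizontal_tangent n q = (snd n, - fst n, 2 * yc q * snd n + 2 * xc q * fst n)"
  by (cases q) (simp add: horizontal_tangent_def xc_def yc_def)

lemma contact_form_eq: "contact_form q u = tc u + 2 * (xc q * yc u - yc q * xc u)"
  by (cases q; cases u) (simp add: xc_def yc_def tc_def)

lemma hnormal_contact_form:
  assumes "\<sigma> differentiable (at w)" "frechet_derivative \<sigma> (at w) (1, 0) = u"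
    "frechet_derivative \<sigma> (at w) (0, 1) = v"
  shows "hnormal \<sigma> w =
    (yc u * contact_form (\<sigma> w) v - yc v * contact_form (\<sigma> w) u,
     xc v * contact_form (\<sigma> w) u - xc u * contact_form (\<sigma> w) v)"
  unfolding hnormal_def jac_def contact_form_eq
    frechet_derivative_bounded_linear_compose[OF bounded_linear_coords(1) assms(1)]
    frechet_derivative_bounded_linear_compose[OF bounded_linear_coords(2) assms(1)]
    frechet_derivative_bounded_linear_compose[OF bounded_linear_coords(3) assms(1)]
    o_apply assms(2,3)
  by (simp add: algebra_simps)

text \<open>If \<open>u\<close> and \<open>v\<close> are the images of the coordinate vectors, then
  \<omega>(u)v - \<omega>(v)u is tangent to the surface and annihilated by \<omega>, hence
  horizontal. Its components are those of the normal after a quarter turn.\<close>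

lemma hnormal_tangent:
  assumes "\<sigma> differentiable (at w)"
  shows "frechet_derivative \<sigma> (at w)
      (- contact_form (\<sigma> w) (frechet_derivative \<sigma> (at w) (0, 1)),
       contact_form (\<sigma> w) (frechet_derivative \<sigma> (at w) (1, 0))) =
    horizontal_tangent (hnormal \<sigma> w) (\<sigma> w)"
  (is "frechet_derivative _ _ ?e = _")
  unfolding linear_pair[OF linear_frechet_derivative[OF assms], of ?e]
  unfolding hnormal_contact_form[OF assms refl refl] horizontal_tangent_eq contact_form_eq
  by (simp add: prod_eq_iff xc_def yc_def tc_def algebra_simps)

text \<open>The normal is bilinear and alternating in the two columns of the differential, so a
  change of parameters multiplies it by the determinant.\<close>

lemma hnormal_compose:
  assumes "\<phi> differentiable (at w)" "\<tau> differentiable (at (\<phi> w))"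
  shows "hnormal (\<tau> \<circ> \<phi>) w = jac (fst \<circ> \<phi>) (snd \<circ> \<phi>) w *\<^sub>R hnormal \<tau> (\<phi> w)"
proof -
  let ?P = "frechet_derivative \<phi> (at w)" and ?T = "frechet_derivative \<tau> (at (\<phi> w))"
  have diff: "(\<tau> \<circ> \<phi>) differentiable (at w)" and D: "frechet_derivative (\<tau> \<circ> \<phi>) (at w) = ?T \<circ> ?P"
    using differentiable_chain_at[OF assms] frechet_derivative_compose[OF assms] by auto
  define u v a b where "u = ?P (1, 0)" and "v = ?P (0, 1)" and "a = ?T (1, 0)" and "b = ?T (0, 1)"
  have T: "?T u = fst u *\<^sub>R a + snd u *\<^sub>R b" "?T v = fst v *\<^sub>R a + snd v *\<^sub>R b"
    unfolding a_def b_def by (rule linear_pair[OF linear_frechet_derivative[OF assms(2)]])+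
  show ?thesis
    unfolding hnormal_contact_form[OF diff refl refl] hnormal_contact_form[OF assms(2) refl refl] D jac_def
      frechet_derivative_bounded_linear_compose[OF bounded_linear_fst assms(1)]
      frechet_derivative_bounded_linear_compose[OF bounded_linear_snd assms(1)]
      o_apply u_def[symmetric] v_def[symmetric] a_def[symmetric] b_def[symmetric] T contact_form_eq
    by (simp add: prod_eq_iff xc_def yc_def tc_def algebra_simps)
qed

lemma smooth_on_hnormal:
  assumes "open U" "smooth_on U \<sigma>"
  shows "smooth_on U (hnormal \<sigma>)"
proof -
  have comp: "smooth_on U (h \<circ> \<sigma>)" if "bounded_linear h" for h :: "heis \<Rightarrow> real"
    using smooth_on_bounded_linear_compose[OF assms(1) that assms(2)] by (simp add: o_def)
  have coord: "smooth_on U (\<lambda>w. h (\<sigma> w))" if "bounded_linear h" for h :: "heis \<Rightarrow> real"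
    using smooth_on_bounded_linear_compose[OF assms(1) that assms(2)] .
  show ?thesis
    unfolding hnormal_def[abs_def] jac_def
    by (intro smooth_on_intros smooth_on_frechet_derivative comp coord assms(1) bounded_linear_coords)
qed

lemma surface_pointsI: "(U, \<sigma>) \<in> S \<Longrightarrow> w \<in> U \<Longrightarrow> \<sigma> w \<in> surface_points S"
  by (auto simp: surface_points_def)

lemma noncharacteristic_hnormal:
  "\<sigma> w \<in> noncharacteristic_points S \<Longrightarrow> (U, \<sigma>) \<in> S \<Longrightarrow> w \<in> U \<Longrightarrow> hnormal \<sigma> w \<noteq> 0"
  by (auto simp: noncharacteristic_points_def char_locus_def)

section \<open>Surfaces as local graphs and the mean curvature\<close>

lemma regular_surface_patch:
  assumes "regular_surface S" "(U, \<sigma>) \<in> S"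
  shows "regular_patch U \<sigma>" "openin (top_of_set (surface_points S)) (\<sigma> ` U)"
    "open U" "smooth_on U \<sigma>" "continuous_on U \<sigma>" "inj_on \<sigma> U"
proof -
  show *: "regular_patch U \<sigma>" "openin (top_of_set (surface_points S)) (\<sigma> ` U)"
    using assms unfolding regular_surface_def by auto
  then show "open U" "smooth_on U \<sigma>" by (auto simp: regular_patch_def)
  then show "continuous_on U \<sigma>" by (simp add: smooth_on_imp_continuous_on)
  show "inj_on \<sigma> U"
    using * unfolding regular_patch_def homeomorphism_def by (metis inj_on_inverseI)
qed

text \<open>\<open>L\<close> is a left inverse of the differential at \<open>w0\<close>, so
  \<open>L \<circ> \<sigma>\<close> has the identity as derivative there and possesses a local
  inverse \<open>G\<close>. Then \<open>\<sigma> \<circ> G\<close> is a section of the linear map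
  \<open>L\<close>, and the surface is a graph over the plane.\<close>

lemma local_graph:
  assumes S: "regular_surface S" "(U, \<sigma>) \<in> S" and w0: "w0 \<in> U"
  obtains L :: "heis \<Rightarrow> real \<times> real" and B G W where
    "bounded_linear L" "open B" "smooth_on B G" "G ` B \<subseteq> U"
    "\<And>z. z \<in> B \<Longrightarrow> L (\<sigma> (G z)) = z" "L (\<sigma> w0) \<in> B" "G (L (\<sigma> w0)) = w0" "open W" "\<sigma> w0 \<in> W"
    "W \<inter> surface_points S = (\<lambda>z. \<sigma> (G z)) ` B" "L ` W \<subseteq> B"
    "\<And>q. q \<in> W \<Longrightarrow> q \<in> surface_points S \<Longrightarrow> \<sigma> (G (L q)) = q"
proof -
  note p = regular_surface_patch[OF S]
  let ?D = "frechet_derivative \<sigma> (at w0)"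
  have "linear ?D" using smooth_on_linear_frechet_derivative[OF p(4) w0] .
  then obtain L :: "heis \<Rightarrow> real \<times> real" where "linear L" and LD: "L \<circ> ?D = id"
    using linear_injective_left_inverse regular_patch_inj[OF p(1) w0] by blast
  then have L: "bounded_linear L" by (simp add: linear_conv_bounded_linear)
  have LS: "smooth_on U (L \<circ> \<sigma>)"
    using smooth_on_bounded_linear_compose[OF p(3) L p(4)] by (simp add: o_def)
  have "frechet_derivative (L \<circ> \<sigma>) (at w0) = id"
    using frechet_derivative_bounded_linear_compose[OF L smooth_on_differentiable[OF p(4) w0]] LD by simp
  then have "inj (frechet_derivative (L \<circ> \<sigma>) (at w0))" by simp
  from smooth_inverse_function[OF p(3) LS w0 this]
  obtain A B G where AB: "open A" "A \<subseteq> U" "w0 \<in> A" "open B" "(L \<circ> \<sigma>) w0 \<in> B"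
      and hom: "homeomorphism A B (L \<circ> \<sigma>) G" and G: "smooth_on B G" by metis
  have GB: "G ` B = A" and GL: "\<And>w. w \<in> A \<Longrightarrow> G (L (\<sigma> w)) = w" and LG: "\<And>z. z \<in> B \<Longrightarrow> L (\<sigma> (G z)) = z"
    using hom by (auto simp: homeomorphism_def)
  obtain g where g: "homeomorphism U (\<sigma> ` U) \<sigma> g" using p(1) by (auto simp: regular_patch_def)
  have "openin (top_of_set (\<sigma> ` U)) (\<sigma> ` A)"
    using homeomorphism_imp_open_map[OF g] AB(1,2) by (simp add: open_subset)
  then have "openin (top_of_set (surface_points S)) (\<sigma> ` A)"
    using p(2) openin_trans by blast
  \<comment> \<open>Embeddedness enters here: \<open>W0\<close> meets the whole surface, not merely
    this patch, only in the image of \<open>A\<close>.\<close>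
  then obtain W0 where W0: "open W0" "\<sigma> ` A = surface_points S \<inter> W0"
    by (auto simp: openin_open)
  define W where "W = {q \<in> W0. L q \<in> B}"
  have sA: "\<sigma> ` A = (\<lambda>z. \<sigma> (G z)) ` B" using GB by (metis image_image)
  have LA: "L q \<in> B" if "q \<in> \<sigma> ` A" for q
    using that hom by (auto simp: homeomorphism_def)
  have W: "W \<inter> surface_points S = (\<lambda>z. \<sigma> (G z)) ` B"
    using W0(2) LA unfolding W_def sA[symmetric] by blast
  show thesis
  proof (rule that[OF L AB(4) G])
    show "open W"
      unfolding W_def using W0(1) AB(4) L linear_continuous_on
      by (intro open_Int_vimage) auto
    show "\<sigma> w0 \<in> W" using W0(2) AB(3) LA unfolding W_def by blast
    show "\<sigma> (G (L q)) = q" if "q \<in> W" "q \<in> surface_points S" for q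
    proof -
      have "q \<in> \<sigma> ` A" using W sA that by blast
      then show ?thesis using GL by auto
    qed
    show "G (L (\<sigma> w0)) = w0" using GL AB(3) .
    show "L (\<sigma> w0) \<in> B" using AB(5) by simp
  qed (use GB AB LG W in \<open>auto simp: W_def\<close>)
qed

text \<open>The atlas prescribes only the sign of the Jacobian expression. Differentiability of the
  transition map comes from the graph representation, by which it is
  \<open>G \<circ> L \<circ> \<sigma>\<close> near \<open>w\<close>.\<close>

lemma transition_map:
  assumes S: "regular_surface S" "(U, \<sigma>) \<in> S" "(V, \<tau>) \<in> S" and w: "w \<in> U" "\<sigma> w \<in> \<tau> ` V"
    and \<phi>_def: "\<phi> = inv_into V \<tau> \<circ> \<sigma>"
  shows "hnormal \<sigma> w = jac (fst \<circ> \<phi>) (snd \<circ> \<phi>) w *\<^sub>R hnormal \<tau> (\<phi> w)"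
    and "jac (fst \<circ> \<phi>) (snd \<circ> \<phi>) w > 0"
proof -
  note p = regular_surface_patch[OF S(1,2)] and p' = regular_surface_patch[OF S(1,3)]
  have \<phi>w: "\<phi> w \<in> V" "\<tau> (\<phi> w) = \<sigma> w"
    using w by (auto simp: \<phi>_def inv_into_into f_inv_into_f)
  obtain L :: "heis \<Rightarrow> real \<times> real" and B G W where L: "bounded_linear L" and B: "open B" and
    G: "smooth_on B G" "G ` B \<subseteq> V" and W: "open W" "\<tau> (\<phi> w) \<in> W" "L ` W \<subseteq> B"
    "\<And>q. q \<in> W \<Longrightarrow> q \<in> surface_points S \<Longrightarrow> \<tau> (G (L q)) = q"
    by (rule local_graph[OF S(1,3) \<phi>w(1)]) blast
  define N where "N = {x \<in> U. \<sigma> x \<in> W}"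
  have N: "open N" "w \<in> N" "N \<subseteq> U"
    using open_Int_vimage[OF p(5,3) W(1)] w(1) W(2) \<phi>w by (auto simp: N_def)
  have eq: "\<tau> (G (L (\<sigma> x))) = \<sigma> x" "\<phi> x = G (L (\<sigma> x))" "G (L (\<sigma> x)) \<in> V" if "x \<in> N" for x
  proof -
    show 1: "\<tau> (G (L (\<sigma> x))) = \<sigma> x"
      using that W(4) surface_pointsI[OF S(2)] by (auto simp: N_def)
    show 2: "G (L (\<sigma> x)) \<in> V"
      using that W(3) G(2) by (auto simp: N_def)
    show "\<phi> x = G (L (\<sigma> x))"
      using inv_into_f_f[OF p'(6) 2] 1 by (simp add: \<phi>_def)
  qed
  have "smooth_on N (\<lambda>x. G (L (\<sigma> x)))"
  proof (rule smooth_on_compose[OF N(1) B _ G(1)])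
    show "smooth_on N (\<lambda>x. L (\<sigma> x))"
      by (rule smooth_on_bounded_linear_compose[OF N(1) L smooth_on_subset[OF p(4) N(3)]])
    show "(\<lambda>x. L (\<sigma> x)) ` N \<subseteq> B" using W(3) by (auto simp: N_def)
  qed
  then have "smooth_on N \<phi>" using smooth_on_cong[OF N(1), of \<phi> "\<lambda>x. G (L (\<sigma> x))"] eq(2) by simp
  then have \<phi>: "\<phi> differentiable (at w)" using N(2) smooth_on_differentiable by blast
  have "hnormal \<sigma> w = hnormal (\<tau> \<circ> \<phi>) w"
  proof -
    have c: "frechet_derivative (h \<circ> \<sigma>) (at w) = frechet_derivative (h \<circ> (\<tau> \<circ> \<phi>)) (at w)" for h :: "heis \<Rightarrow> real"
      by (rule frechet_derivative_cong_open[OF N(1,2)]) (simp add: eq)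
    show ?thesis unfolding hnormal_def jac_def c using \<phi>w by simp
  qed
  then show "hnormal \<sigma> w = jac (fst \<circ> \<phi>) (snd \<circ> \<phi>) w *\<^sub>R hnormal \<tau> (\<phi> w)"
    using hnormal_compose[OF \<phi> smooth_on_differentiable[OF p'(4) \<phi>w(1)]] by simp
  show "jac (fst \<circ> \<phi>) (snd \<circ> \<phi>) w > 0"
    using S w unfolding regular_surface_def \<phi>_def by fastforce
qed

text \<open>Normals of two patches differ by the positive Jacobian of the transition map, which
  \<open>sgn\<close> removes; the unit normal is thus a function on the oriented surface.\<close>

lemma sgn_hnormal_unique:
  assumes S: "regular_surface S" "(U, \<sigma>) \<in> S" "(V, \<tau>) \<in> S" and w: "w \<in> U" "w' \<in> V" "\<sigma> w = \<tau> w'"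
  shows "sgn (hnormal \<sigma> w) = sgn (hnormal \<tau> w')"
proof -
  have "\<sigma> w \<in> \<tau> ` V" using w by auto
  moreover have "inv_into V \<tau> (\<sigma> w) = w'"
    using w regular_surface_patch(6)[OF S(1,3)] by (simp add: inv_into_f_f)
  ultimately show ?thesis
    using transition_map[OF S w(1) _ refl] by (simp add: sgn_scaleR)
qed

section \<open>The mean curvature as the rotation rate of the unit normal\<close>

lemma linear_horizontal_tangent:
  fixes f :: "heis \<Rightarrow> real"
  assumes "linear f"
  shows "f (horizontal_tangent n q) = snd n * f (XH q) - fst n * f (YH q)"
  using assms by (simp add: horizontal_tangent_def linear_diff linear_scale)

lemma unit_field_derivative:
  assumes \<nu>: "(\<nu>\<^sub>1 has_derivative D\<^sub>1) (at p)" "(\<nu>\<^sub>2 has_derivative D\<^sub>2) (at p)"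
    and W: "open W" "p \<in> W" and unit: "\<And>q. q \<in> W \<Longrightarrow> (\<nu>\<^sub>1 q)\<^sup>2 + (\<nu>\<^sub>2 q)\<^sup>2 = (1 :: real)"
  shows "\<nu>\<^sub>1 p * D\<^sub>1 v + \<nu>\<^sub>2 p * D\<^sub>2 v = 0"
proof -
  have "((\<lambda>q. \<nu>\<^sub>1 q * \<nu>\<^sub>1 q + \<nu>\<^sub>2 q * \<nu>\<^sub>2 q) has_derivative
      (\<lambda>v. (\<nu>\<^sub>1 p * D\<^sub>1 v + D\<^sub>1 v * \<nu>\<^sub>1 p) + (\<nu>\<^sub>2 p * D\<^sub>2 v + D\<^sub>2 v * \<nu>\<^sub>2 p))) (at p)"
    by (intro has_derivative_add has_derivative_mult \<nu>)
  moreover have "((\<lambda>q. \<nu>\<^sub>1 q * \<nu>\<^sub>1 q + \<nu>\<^sub>2 q * \<nu>\<^sub>2 q) has_derivative (\<lambda>v. 0)) (at p)"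
    by (rule has_derivative_transform_within_open[OF has_derivative_const W])
      (use unit in \<open>simp add: power2_eq_square\<close>)
  ultimately have "(\<lambda>v. (\<nu>\<^sub>1 p * D\<^sub>1 v + D\<^sub>1 v * \<nu>\<^sub>1 p) + (\<nu>\<^sub>2 p * D\<^sub>2 v + D\<^sub>2 v * \<nu>\<^sub>2 p)) = (\<lambda>v. 0)"
    by (rule has_derivative_unique)
  from fun_cong[OF this, of v] show ?thesis by (simp add: algebra_simps)
qed

text \<open>Differentiating \<open>\<nu>\<^sub>1\<^sup>2 + \<nu>\<^sub>2\<^sup>2 = 1\<close> leaves only the derivative along the horizontal tangent,
  which is why the horizontal mean curvature does not depend on the extension of the normal.\<close>

lemma horizontal_divergence:
  fixes p :: heis
  assumes \<nu>: "(\<nu>\<^sub>1 has_derivative D\<^sub>1) (at p)" "(\<nu>\<^sub>2 has_derivative D\<^sub>2) (at p)"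
    and W: "open W" "p \<in> W" and unit: "\<And>q. q \<in> W \<Longrightarrow> (\<nu>\<^sub>1 q)\<^sup>2 + (\<nu>\<^sub>2 q)\<^sup>2 = (1 :: real)"
  shows "D\<^sub>1 (XH p) + D\<^sub>2 (YH p) =
    \<nu>\<^sub>2 p * D\<^sub>1 (horizontal_tangent (\<nu>\<^sub>1 p, \<nu>\<^sub>2 p) p) - \<nu>\<^sub>1 p * D\<^sub>2 (horizontal_tangent (\<nu>\<^sub>1 p, \<nu>\<^sub>2 p) p)"
proof -
  note lin = has_derivative_bounded_linear[OF \<nu>(1), THEN bounded_linear.linear]
    has_derivative_bounded_linear[OF \<nu>(2), THEN bounded_linear.linear]
  define a b where "a = \<nu>\<^sub>1 p" and "b = \<nu>\<^sub>2 p"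
  define X1 X2 Y1 Y2 where "X1 = D\<^sub>1 (XH p)" and "X2 = D\<^sub>2 (XH p)" and "Y1 = D\<^sub>1 (YH p)" and "Y2 = D\<^sub>2 (YH p)"
  have e: "a * X1 + b * X2 = 0" "a * Y1 + b * Y2 = 0" "a\<^sup>2 + b\<^sup>2 = 1"
    using unit_field_derivative[OF \<nu> W unit] unit[OF W(2)]
    by (auto simp: a_def b_def X1_def X2_def Y1_def Y2_def)
  \<comment> \<open>Multiply \<open>X1\<close> and \<open>Y2\<close> by
    \<open>a\<^sup>2 + b\<^sup>2\<close>, and replace \<open>a * X1\<close> by
    \<open>- b * X2\<close> and \<open>b * Y2\<close> by \<open>- a * Y1\<close>.\<close>
  have "X1 + Y2 = b * (b * X1 - a * Y1) - a * (b * X2 - a * Y2)"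
    using e by algebra
  then show ?thesis
    by (simp add: linear_horizontal_tangent[OF lin(1)] linear_horizontal_tangent[OF lin(2)]
        a_def b_def X1_def X2_def Y1_def Y2_def)
qed

text \<open>The right-hand side no longer mentions the extension of the normal, so it determines the
  value. It arises from \<open>horizontal_divergence\<close> by the chain rule, since
  \<open>e\<close> is the parameter direction that \<sigma> carries to the horizontal
  tangent.\<close>

lemma horizontal_mean_curvature_in_patch:
  assumes S: "regular_surface S" "(U, \<sigma>) \<in> S" and w: "w \<in> U" "hnormal \<sigma> w \<noteq> 0"
    and h: "has_horizontal_mean_curvature S (\<sigma> w) h"
    and e: "frechet_derivative \<sigma> (at w) e = horizontal_tangent (sgn (hnormal \<sigma> w)) (\<sigma> w)"
    and n_def: "n = (\<lambda>w. sgn (hnormal \<sigma> w))"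
  shows "h = snd (n w) * frechet_derivative (\<lambda>w. fst (n w)) (at w) e
    - fst (n w) * frechet_derivative (\<lambda>w. snd (n w)) (at w) e"
proof -
  note p = regular_surface_patch[OF S]
  obtain W \<nu>\<^sub>1 \<nu>\<^sub>2 where W: "open W" "\<sigma> w \<in> W" and sm: "smooth_on W \<nu>\<^sub>1" "smooth_on W \<nu>\<^sub>2"
    and unit: "\<And>q. q \<in> W \<Longrightarrow> (\<nu>\<^sub>1 q)\<^sup>2 + (\<nu>\<^sub>2 q)\<^sup>2 = 1"
    and \<nu>S: "\<forall>(U, \<sigma>)\<in>S. \<forall>w\<in>U. \<sigma> w \<in> W \<and> hnormal \<sigma> w \<noteq> 0 \<longrightarrow>
      (\<nu>\<^sub>1 (\<sigma> w), \<nu>\<^sub>2 (\<sigma> w)) = sgn (hnormal \<sigma> w)"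
    and heq: "h = frechet_derivative \<nu>\<^sub>1 (at (\<sigma> w)) (XH (\<sigma> w)) + frechet_derivative \<nu>\<^sub>2 (at (\<sigma> w)) (YH (\<sigma> w))"
    using h unfolding has_horizontal_mean_curvature_def by (elim exE conjE) (rule that; simp)
  have \<nu>: "(\<nu>\<^sub>1 (\<sigma> x), \<nu>\<^sub>2 (\<sigma> x)) = n x" if "x \<in> U" "\<sigma> x \<in> W" "hnormal \<sigma> x \<noteq> 0" for x
    using bspec[OF \<nu>S S(2)] that by (simp add: n_def)
  define N where "N = {x \<in> {x \<in> U. \<sigma> x \<in> W}. hnormal \<sigma> x \<in> - {0}}"
  have cont: "continuous_on U (hnormal \<sigma>)"
    using smooth_on_hnormal[OF p(3,4)] smooth_on_imp_continuous_on by blast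
  have N: "open N"
    unfolding N_def
    by (rule open_Int_vimage[OF continuous_on_subset[OF cont] open_Int_vimage[OF p(5,3) W(1)]]) auto
  have wN: "w \<in> N" using w W by (simp add: N_def)
  have nN: "\<nu>\<^sub>1 (\<sigma> x) = fst (n x)" "\<nu>\<^sub>2 (\<sigma> x) = snd (n x)" if "x \<in> N" for x
    using \<nu>[of x] that by (auto simp: N_def prod_eq_iff)
  let ?D\<^sub>1 = "frechet_derivative \<nu>\<^sub>1 (at (\<sigma> w))" and ?D\<^sub>2 = "frechet_derivative \<nu>\<^sub>2 (at (\<sigma> w))"
  note D = smooth_on_has_derivative[OF sm(1) W(2)] smooth_on_has_derivative[OF sm(2) W(2)]
  note \<sigma>' = smooth_on_has_derivative[OF p(4) w(1)]
  have "frechet_derivative (\<lambda>x. fst (n x)) (at w) = (\<lambda>v. ?D\<^sub>1 (frechet_derivative \<sigma> (at w) v))"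
    "frechet_derivative (\<lambda>x. snd (n x)) (at w) = (\<lambda>v. ?D\<^sub>2 (frechet_derivative \<sigma> (at w) v))"
    by (auto intro!: frechet_derivative_eqI
        has_derivative_transform_within_open[OF has_derivative_compose[OF \<sigma>' D(1)] N wN nN(1)]
        has_derivative_transform_within_open[OF has_derivative_compose[OF \<sigma>' D(2)] N wN nN(2)])
  moreover have "(\<nu>\<^sub>1 (\<sigma> w), \<nu>\<^sub>2 (\<sigma> w)) = n w" using \<nu>[OF w(1) W(2) w(2)] .
  moreover have "h = \<nu>\<^sub>2 (\<sigma> w) * ?D\<^sub>1 (horizontal_tangent (\<nu>\<^sub>1 (\<sigma> w), \<nu>\<^sub>2 (\<sigma> w)) (\<sigma> w))
      - \<nu>\<^sub>1 (\<sigma> w) * ?D\<^sub>2 (horizontal_tangent (\<nu>\<^sub>1 (\<sigma> w), \<nu>\<^sub>2 (\<sigma> w)) (\<sigma> w))"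
    unfolding heq by (rule horizontal_divergence[OF D W unit])
  ultimately show ?thesis using e nN[OF wN] by (simp add: n_def)
qed

text \<open>Rescaling \<open>hnormal_tangent\<close> by the inverse norm of the normal; where the
  normal vanishes, the right-hand side is zero too.\<close>

lemma exists_horizontal_tangent:
  assumes "\<sigma> differentiable (at w)"
  shows "\<exists>e. frechet_derivative \<sigma> (at w) e = horizontal_tangent (sgn (hnormal \<sigma> w)) (\<sigma> w)"
proof -
  have "horizontal_tangent (c *\<^sub>R n) q = c *\<^sub>R horizontal_tangent n q" for c n q
    by (simp add: horizontal_tangent_eq algebra_simps)
  then show ?thesis
    using hnormal_tangent[OF assms] linear_scale[OF linear_frechet_derivative[OF assms]]
    by (metis sgn_div_norm)
qed

lemma horizontal_mean_curvature_eqI: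
  assumes S: "regular_surface S" and q: "q \<in> noncharacteristic_points S"
    and h: "has_horizontal_mean_curvature S q h"
  shows "horizontal_mean_curvature S q = h"
proof -
  obtain U \<sigma> w where p: "(U, \<sigma>) \<in> S" "w \<in> U" "q = \<sigma> w"
    using q by (auto simp: noncharacteristic_points_def surface_points_def)
  have nz: "hnormal \<sigma> w \<noteq> 0" using noncharacteristic_hnormal[of \<sigma> w S U] q p by blast
  obtain e where "frechet_derivative \<sigma> (at w) e = horizontal_tangent (sgn (hnormal \<sigma> w)) (\<sigma> w)"
    using exists_horizontal_tangent smooth_on_differentiable regular_surface_patch(4)[OF S p(1)] p(2) by blast
  note eq = horizontal_mean_curvature_in_patch[OF S p(1,2) nz _ this refl, folded p(3)]
  have "h' = h" if "has_horizontal_mean_curvature S q h'" for h'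
    using eq[OF that] eq[OF h] by (rule trans[OF _ sym])
  then show ?thesis
    unfolding horizontal_mean_curvature_def using h by (rule the_equality[rotated])
qed

text \<open>A noncharacteristic piece of the surface as a graph over the plane: \<open>T\<close>
  parametrises it and \<open>L\<close> projects back, so maps on \<open>B\<close> extend to
  \<open>W\<close> by composition with \<open>L\<close>. The normal \<open>n\<close> is tied to the
  patches of \<open>S\<close>, not to \<open>T\<close>, and so carries the orientation of
  \<open>S\<close>. The last condition says that \<open>L\<close> finds the parameter direction of
  the horizontal tangent.\<close>

locale horizontal_graph =
  fixes S :: surface and L :: "heis \<Rightarrow> real \<times> real" and B :: "(real \<times> real) set"
    and T :: "real \<times> real \<Rightarrow> heis" and W :: "heis set" and n :: "real \<times> real \<Rightarrow> real \<times> real"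
  assumes L: "bounded_linear L" and B: "open B" and T: "smooth_on B T"
    and L_T: "\<And>z. z \<in> B \<Longrightarrow> L (T z) = z"
    and W: "open W" "W \<inter> surface_points S = T ` B" "L ` W \<subseteq> B"
    and n: "smooth_on B n" "\<And>z. z \<in> B \<Longrightarrow> (fst (n z))\<^sup>2 + (snd (n z))\<^sup>2 = 1"
    and n_hnormal: "\<And>U \<sigma> w. (U, \<sigma>) \<in> S \<Longrightarrow> w \<in> U \<Longrightarrow> \<sigma> w \<in> W \<Longrightarrow>
      hnormal \<sigma> w \<noteq> 0 \<and> sgn (hnormal \<sigma> w) = n (L (\<sigma> w))"
    and n_tangent: "\<And>z. z \<in> B \<Longrightarrow>
      frechet_derivative T (at z) (L (horizontal_tangent (n z) (T z))) = horizontal_tangent (n z) (T z)"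

lemma horizontal_graph_exists:
  assumes S: "regular_surface S" and p: "p \<in> noncharacteristic_points S"
  obtains L B T W n where "horizontal_graph S L B T W n" "p \<in> W"
proof -
  obtain U \<sigma> w0 where S\<sigma>: "(U, \<sigma>) \<in> S" and w0: "w0 \<in> U" "p = \<sigma> w0"
    using p by (auto simp: noncharacteristic_points_def surface_points_def)
  have nz: "hnormal \<sigma> w0 \<noteq> 0" using noncharacteristic_hnormal[of \<sigma> w0 S U] p w0 S\<sigma> by blast
  note \<sigma> = regular_surface_patch[OF S S\<sigma>]
  obtain L :: "heis \<Rightarrow> real \<times> real" and B0 G W0 where L: "bounded_linear L" and B0: "open B0" and
    G: "smooth_on B0 G" "G ` B0 \<subseteq> U" "\<And>z. z \<in> B0 \<Longrightarrow> L (\<sigma> (G z)) = z" and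
    w0B: "L (\<sigma> w0) \<in> B0" "G (L (\<sigma> w0)) = w0" and W0: "open W0" "\<sigma> w0 \<in> W0"
    "W0 \<inter> surface_points S = (\<lambda>z. \<sigma> (G z)) ` B0" "L ` W0 \<subseteq> B0"
    "\<And>q. q \<in> W0 \<Longrightarrow> q \<in> surface_points S \<Longrightarrow> \<sigma> (G (L q)) = q"
    by (rule local_graph[OF S S\<sigma> w0(1)]) blast
  define N where "N = (\<lambda>z. hnormal \<sigma> (G z))"
  define T where "T = (\<lambda>z. \<sigma> (G z))"
  define B where "B = {z \<in> B0. N z \<in> - {0}}"
  define W where "W = {q \<in> W0. L q \<in> B}"
  define n where "n = (\<lambda>z. inverse (sqrt ((fst (N z))\<^sup>2 + (snd (N z))\<^sup>2)) *\<^sub>R N z)"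
  have n_sgn: "n z = sgn (N z)" for z
    by (simp add: n_def sgn_div_norm norm_prod_def)
  have N: "smooth_on B0 N"
    unfolding N_def by (rule smooth_on_compose[OF B0 \<sigma>(3) G(1) smooth_on_hnormal[OF \<sigma>(3,4)] G(2)])
  have B: "open B" "B \<subseteq> B0"
    unfolding B_def by (rule open_Int_vimage[OF smooth_on_imp_continuous_on[OF N] B0]) auto
  have pos: "(fst (N z))\<^sup>2 + (snd (N z))\<^sup>2 > 0" if "z \<in> B" for z
    using that by (auto simp: B_def prod_eq_iff sum_power2_gt_zero_iff)
  note NB = smooth_on_subset[OF N B(2)]
  have smn: "smooth_on B n"
    unfolding n_def using pos by (intro smooth_on_intros smooth_on_inverse smooth_on_sqrt NB B(1)) force+
  have smT: "smooth_on B T"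
    unfolding T_def
    by (rule smooth_on_subset[OF smooth_on_compose[OF B0 \<sigma>(3) G(1) \<sigma>(4) G(2)] B(2)])
  have openW: "open W"
    unfolding W_def using W0(1) B L linear_continuous_on by (intro open_Int_vimage) auto
  have TB: "T z \<in> W" if "z \<in> B" for z
  proof -
    have z: "z \<in> B0" using that B(2) by blast
    then have "\<sigma> (G z) \<in> W0" using W0(3) by blast
    then show ?thesis using G(3)[OF z] that by (simp add: W_def T_def)
  qed
  have "horizontal_graph S L B T W n"
  proof (rule horizontal_graph.intro)
    show LT: "L (T z) = z" if "z \<in> B" for z using G(3)[OF subsetD[OF B(2) that]] by (simp add: T_def)
    show "W \<inter> surface_points S = T ` B"
    proof
      show "W \<inter> surface_points S \<subseteq> T ` B"
      proof
        fix q assume "q \<in> W \<inter> surface_points S"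
        then have "T (L q) = q" "L q \<in> B" using W0(5) by (auto simp: W_def T_def)
        then show "q \<in> T ` B" by (metis imageI)
      qed
      show "T ` B \<subseteq> W \<inter> surface_points S"
        using TB image_mono[OF B(2), of T] W0(3) unfolding T_def by blast
    qed
    show "L ` W \<subseteq> B" by (auto simp: W_def)
    show "(fst (n z))\<^sup>2 + (snd (n z))\<^sup>2 = 1" if "z \<in> B" for z
    proof -
      have "norm (n z) = 1" using pos[OF that] by (auto simp: n_sgn norm_sgn)
      then show ?thesis by (simp add: norm_prod_def)
    qed
    show "hnormal \<tau> w \<noteq> 0 \<and> sgn (hnormal \<tau> w) = n (L (\<tau> w))"
      if "(V, \<tau>) \<in> S" "w \<in> V" "\<tau> w \<in> W" for V \<tau> w
    proof -
      have z: "L (\<tau> w) \<in> B" "\<sigma> (G (L (\<tau> w))) = \<tau> w"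
        using that W0(5) surface_pointsI[OF that(1,2)] by (auto simp: W_def)
      then have "G (L (\<tau> w)) \<in> U" using B(2) G(2) by blast
      then have "sgn (hnormal \<tau> w) = n (L (\<tau> w))"
        using sgn_hnormal_unique[OF S S\<sigma> that(1) _ that(2) z(2)] by (simp add: n_sgn N_def)
      moreover have "n (L (\<tau> w)) \<noteq> 0" using pos[OF z(1)] by (auto simp: n_sgn sgn_zero_iff)
      ultimately show ?thesis by (metis sgn_zero)
    qed
    show "frechet_derivative T (at z) (L (horizontal_tangent (n z) (T z))) = horizontal_tangent (n z) (T z)"
      if z: "z \<in> B" for z
    proof -
      define w where "w = G z"
      have w: "w \<in> U" "\<sigma> w = T z" "L (\<sigma> w) = z" "hnormal \<sigma> w = N z"
        using subsetD[OF B(2) z] G(2) G(3)[OF subsetD[OF B(2) z]] by (auto simp: w_def T_def N_def)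
      note \<sigma>w = smooth_on_has_derivative[OF \<sigma>(4) w(1)]
      define V where "V = {x \<in> U. \<sigma> x \<in> W}"
      have V: "open V" "w \<in> V"
        using open_Int_vimage[OF \<sigma>(5,3) openW] w TB[OF z] by (auto simp: V_def)
      \<comment> \<open>Near \<open>w\<close> the map \<sigma> equals
        \<open>T \<circ> L \<circ> \<sigma>\<close>; differentiating, the differential of
        \<open>T\<close> after \<open>L\<close> is the identity on tangent vectors.\<close>
      have "(\<sigma> has_derivative (\<lambda>v. frechet_derivative T (at z) (L (frechet_derivative \<sigma> (at w) v)))) (at w)"
      proof (rule has_derivative_transform_within_open[OF _ V])
        have "(T has_derivative frechet_derivative T (at z)) (at (L (\<sigma> w)))"
          using smooth_on_has_derivative[OF smT z] w by simp
        from has_derivative_compose[OF bounded_linear.has_derivative[OF L \<sigma>w] this]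
        show "((\<lambda>x. T (L (\<sigma> x))) has_derivative
            (\<lambda>v. frechet_derivative T (at z) (L (frechet_derivative \<sigma> (at w) v)))) (at w)" .
        show "T (L (\<sigma> x)) = \<sigma> x" if "x \<in> V" for x
          using that W0(5) surface_pointsI[OF S\<sigma>] by (auto simp: V_def W_def T_def)
      qed
      then have chain: "frechet_derivative T (at z) (L (frechet_derivative \<sigma> (at w) v)) = frechet_derivative \<sigma> (at w) v" for v
        using frechet_derivative_eqI by metis
      obtain e where "frechet_derivative \<sigma> (at w) e = horizontal_tangent (n z) (T z)"
        using exists_horizontal_tangent[OF smooth_on_differentiable[OF \<sigma>(4) w(1)]] w n_sgn by auto
      then show ?thesis using chain[of e] by simp
    qed
  qed (fact L B(1) smT openW smn)+
  moreover have "p \<in> W" using w0 w0B W0(2) nz by (auto simp: W_def B_def N_def)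
  ultimately show thesis using that by blast
qed

context horizontal_graph
begin

lemma noncharacteristic: "W \<inter> surface_points S \<subseteq> noncharacteristic_points S"
  using n_hnormal by (auto simp: noncharacteristic_points_def char_locus_def)

text \<open>The extension \<open>n \<circ> L\<close> of the unit normal witnesses that a value
  exists.\<close>

lemma mean_curvature:
  assumes "q \<in> W"
  shows "has_horizontal_mean_curvature S q
    (frechet_derivative (\<lambda>q. fst (n (L q))) (at q) (XH q) + frechet_derivative (\<lambda>q. snd (n (L q))) (at q) (YH q))"
proof -
  have "smooth_on W (\<lambda>q. n (L q))"
    using smooth_on_compose[OF W(1) B smooth_on_bounded_linear[OF W(1) L] n(1) W(3)] .
  then have sm: "smooth_on W (\<lambda>q. fst (n (L q)))" "smooth_on W (\<lambda>q. snd (n (L q)))"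
    using W(1) by (auto intro: smooth_on_fst smooth_on_snd)
  have "(fst (n (L q)))\<^sup>2 + (snd (n (L q)))\<^sup>2 = 1" if "q \<in> W" for q
    using W(3) n(2) that by blast
  then show ?thesis
    unfolding has_horizontal_mean_curvature_def using assms W(1) sm n_hnormal
    by (intro exI[of _ W] exI[of _ "\<lambda>q. fst (n (L q))"] exI[of _ "\<lambda>q. snd (n (L q))"]) auto
qed

text \<open>The derivative of \<open>n\<close> along the tangent has no component along
  \<open>n\<close> because \<open>n\<close> has unit length, and none across it because that
  component is the mean curvature.\<close>

lemma normal_constant_along_tangent:
  assumes S: "regular_surface S" "zero_horizontal_mean_curvature S" and z: "z \<in> B"
  shows "frechet_derivative n (at z) (L (horizontal_tangent (n z) (T z))) = 0"
proof -
  define q where "q = T z"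
  have q: "q \<in> W" "q \<in> noncharacteristic_points S" "L q = z"
    using W(2) z noncharacteristic L_T by (auto simp: q_def)
  let ?D = "\<lambda>v. frechet_derivative n (at z) (L v)"
  have n': "((\<lambda>q. n (L q)) has_derivative ?D) (at q)"
    using has_derivative_compose[OF bounded_linear_imp_has_derivative[OF L, of "at q"]]
      smooth_on_has_derivative[OF n(1) z] q(3) by simp
  have D: "((\<lambda>q. fst (n (L q))) has_derivative (\<lambda>v. fst (?D v))) (at q)"
    "((\<lambda>q. snd (n (L q))) has_derivative (\<lambda>v. snd (?D v))) (at q)"
    using bounded_linear.has_derivative[OF bounded_linear_fst n']
      bounded_linear.has_derivative[OF bounded_linear_snd n'] by auto
  have unit: "(fst (n (L q)))\<^sup>2 + (snd (n (L q)))\<^sup>2 = 1" if "q \<in> W" for q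
    using W(3) n(2) that by blast
  let ?v = "horizontal_tangent (n z) (T z)"
  have "fst (?D (XH q)) + snd (?D (YH q)) = 0"
    using horizontal_mean_curvature_eqI[OF S(1) q(2) mean_curvature[OF q(1)]] S(2) q(2)
      frechet_derivative_eqI[OF D(1)] frechet_derivative_eqI[OF D(2)]
    by (simp add: zero_horizontal_mean_curvature_def)
  then have 1: "snd (n z) * fst (?D ?v) - fst (n z) * snd (?D ?v) = 0"
    using horizontal_divergence[OF D W(1) q(1) unit] q(3) by (simp add: q_def)
  have 2: "fst (n z) * fst (?D ?v) + snd (n z) * snd (?D ?v) = 0"
    using unit_field_derivative[OF D W(1) q(1) unit, of ?v] q(3) by simp
  have "fst (?D ?v) = 0" "snd (?D ?v) = 0"
    using 1 2 n(2)[OF z] by algebra+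
  then show ?thesis by (simp add: prod_eq_iff)
qed

end

section \<open>Legendrian foliated patches are contactomorphic to the plane\<close>

text \<open>The only transition map is the identity, of Jacobian 1, and the image of the patch is
  the entire surface.\<close>

lemma regular_surface_single:
  assumes "regular_patch U \<sigma>"
  shows "regular_surface {(U, \<sigma>)}"
proof -
  have U: "open U" "inj_on \<sigma> U"
    using assms unfolding regular_patch_def homeomorphism_def by (auto intro: inj_on_inverseI)
  have "jac (fst \<circ> (inv_into U \<sigma> \<circ> \<sigma>)) (snd \<circ> (inv_into U \<sigma> \<circ> \<sigma>)) w = 1" if "w \<in> U" for w
  proof -
    have "frechet_derivative (h \<circ> (inv_into U \<sigma> \<circ> \<sigma>)) (at w) = h"
      if "bounded_linear h" for h :: "real \<times> real \<Rightarrow> real"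
      using that \<open>w \<in> U\<close> U by (intro frechet_derivative_eqI
        has_derivative_transform_within_open[OF bounded_linear_imp_has_derivative[OF that] U(1)]) auto
    then show ?thesis by (simp add: jac_def bounded_linear_fst bounded_linear_snd)
  qed
  then show ?thesis
    using assms by (auto simp: regular_surface_def surface_points_def)
qed

lemma noncharacteristic_points_single:
  assumes "regular_patch U \<sigma>"
  shows "noncharacteristic_points {(U, \<sigma>)} = \<sigma> ` {w \<in> U. hnormal \<sigma> w \<noteq> 0}"
proof -
  have "inj_on \<sigma> U"
    using assms unfolding regular_patch_def homeomorphism_def by (auto intro: inj_on_inverseI)
  then show ?thesis
    by (auto simp: noncharacteristic_points_def surface_points_def char_locus_def inj_on_def)
qed

section \<open>The complex plane as a surface\<close>

abbreviation plane_embedding :: "real \<times> real \<Rightarrow> heis" where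
  "plane_embedding z \<equiv> (fst z, snd z, 0)"

lemma bounded_linear_plane_embedding: "bounded_linear plane_embedding"
  by (intro bounded_linear_Pair bounded_linear_fst bounded_linear_snd bounded_linear_zero)

lemma complex_plane_eq: "complex_plane = {(UNIV, plane_embedding)}"
  by (simp add: complex_plane_def case_prod_unfold)

lemma regular_patch_plane_embedding: "regular_patch UNIV plane_embedding"
proof (rule regular_patchI[where g = "\<lambda>q. (fst q, fst (snd q))"])
  have "bounded_linear (\<lambda>q :: heis. (fst q, fst (snd q)))"
    by (intro bounded_linear_Pair bounded_linear_fst bounded_linear_compose[OF bounded_linear_fst bounded_linear_snd])
  then show "(\<lambda>q :: heis. (fst q, fst (snd q))) differentiable at x" for x
    using bounded_linear_imp_differentiable by blast
qed (auto intro: smooth_on_bounded_linear bounded_linear_plane_embedding)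

text \<open>The normal at \<open>(x, y)\<close> is \<open>(2 * y, - 2 * x)\<close>, so the origin is
  the only characteristic point.\<close>

lemma noncharacteristic_points_complex_plane:
  "noncharacteristic_points complex_plane = plane_embedding ` (- {0})"
proof -
  have D: "frechet_derivative plane_embedding (at w) = plane_embedding" for w
    by (rule frechet_derivative_eqI[OF bounded_linear_imp_has_derivative[OF bounded_linear_plane_embedding]])
  have "plane_embedding differentiable (at w)" for w
    by (rule bounded_linear_imp_differentiable[OF bounded_linear_plane_embedding])
  from hnormal_contact_form[OF this refl refl]
  have "hnormal plane_embedding w = (2 * snd w, - 2 * fst w)" for w
    by (simp add: D xc_def yc_def contact_form_eq tc_def)
  then show ?thesis
    unfolding complex_plane_eq noncharacteristic_points_single[OF regular_patch_plane_embedding]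
    by (auto simp: prod_eq_iff)
qed

lemma smooth_on_contact_form:
  assumes "open U" "smooth_on U \<sigma>"
  shows "smooth_on U (\<lambda>w. contact_form (\<sigma> w) (frechet_derivative \<sigma> (at w) v))"
proof -
  have "smooth_on U (\<lambda>w. h (\<sigma> w))" "smooth_on U (\<lambda>w. h (frechet_derivative \<sigma> (at w) v))"
    if "bounded_linear h" for h :: "heis \<Rightarrow> real"
    using assms by (auto intro!: smooth_on_bounded_linear_compose[OF _ that] smooth_on_frechet_derivative)
  then show ?thesis
    unfolding contact_form_eq by (intro smooth_on_intros assms(1)) (simp_all add: bounded_linear_coords)
qed

lemma linear_contact_form: "linear (contact_form q)"
  by (rule linearI) (simp_all add: contact_form_eq xc_def yc_def tc_def algebra_simps)

lemma exp_polar_has_derivative: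
  "((\<lambda>w. (exp (snd w) * cos (fst w), exp (snd w) * sin (fst w))) has_derivative
    (\<lambda>e. (exp (snd w) * (snd e * cos (fst w) - fst e * sin (fst w)),
          exp (snd w) * (snd e * sin (fst w) + fst e * cos (fst w))))) (at (w :: real \<times> real))"
  by (auto intro!: derivative_eq_intros simp: algebra_simps)

text \<open>The target leaves are the rays through the origin: if the second coordinate lines of a patch
  are Legendrian, both contact forms are multiples of the differential of the first coordinate,
  with \<open>(s,v) \<mapsto> e\<^sup>v (cos s, sin s)\<close> pulling \<open>2 r\<^sup>2 d\<theta>\<close> back to \<open>2 e\<^bsup>2v\<^esup> ds\<close>.\<close>

lemma legendrian_patch_contactomorphic:
  assumes patch: "regular_patch D \<sigma>"
    and leg: "\<And>w. w \<in> D \<Longrightarrow> contact_form (\<sigma> w) (frechet_derivative \<sigma> (at w) (0, 1)) = 0"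
  shows "locally_contactomorphic {(D, \<sigma>)} complex_plane"
proof -
  have D: "open D" "smooth_on D \<sigma>" and inj: "inj_on \<sigma> D"
    using patch unfolding regular_patch_def homeomorphism_def by (auto intro: inj_on_inverseI)
  obtain g where g: "homeomorphism D (\<sigma> ` D) \<sigma> g" using patch by (auto simp: regular_patch_def)
  have inv: "inv_into D \<sigma> (\<sigma> w) = w" if "w \<in> D" for w
    using inv_into_f_f[OF inj that] .
  define q where "q = (\<lambda>w. contact_form (\<sigma> w) (frechet_derivative \<sigma> (at w) (1, 0)))"
  define D' where "D' = {w \<in> D. hnormal \<sigma> w \<in> - {0}}"
  define M where "M = noncharacteristic_points {(D, \<sigma>)}"
  define M' where "M' = noncharacteristic_points complex_plane"
  define E where "E = (\<lambda>w :: real \<times> real. (exp (snd w) * cos (fst w), exp (snd w) * sin (fst w)))"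
  define f where "f = (\<lambda>p. plane_embedding (E (inv_into D \<sigma> p)))"
  \<comment> \<open>By \<open>leg\<close> the patch pulls the contact form back to \<open>q\<close>
    ds, and \<open>E\<close> pulls that of the plane back to 2 exp(v)^2 ds; \<open>l\<close> is the
    quotient.\<close>
  define l where "l = (\<lambda>p. 2 * exp (snd (inv_into D \<sigma> p))^2 / q (inv_into D \<sigma> p))"
  have D': "open D'" "D' \<subseteq> D"
    unfolding D'_def
    by (rule open_Int_vimage[OF smooth_on_imp_continuous_on[OF smooth_on_hnormal[OF D]] D(1)]) auto
  have M: "M = \<sigma> ` D'"
    unfolding M_def D'_def noncharacteristic_points_single[OF patch] by simp
  have preM: "{w \<in> D. \<sigma> w \<in> \<sigma> ` X} = X" if "X \<subseteq> D" for X
    using that inj by (auto simp: inj_on_def)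
  have M': "M' = plane_embedding ` (- {0})"
    unfolding M'_def by (rule noncharacteristic_points_complex_plane)
  have smooth_q: "smooth_on D q"
    unfolding q_def by (rule smooth_on_contact_form[OF D])
  \<comment> \<open>When the second column is Legendrian, the normal is \<open>q\<close> times a
    vector, so it can be nonzero only if \<open>q\<close> is.\<close>
  have q0: "q w \<noteq> 0" if "w \<in> D'" for w
  proof
    assume "q w = 0"
    moreover have "w \<in> D" using that D' by blast
    ultimately have "hnormal \<sigma> w = 0"
      using hnormal_contact_form[OF smooth_on_differentiable[OF D(2)] refl refl] leg
      by (simp add: q_def prod_eq_iff)
    then show False using that by (simp add: D'_def)
  qed
  have E0: "E w \<noteq> 0" for w
  proof
    assume "E w = 0"
    then have "cos (fst w) = 0" "sin (fst w) = 0" by (auto simp: E_def prod_eq_iff)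
    then show False using sin_cos_squared_add[of "fst w"] by simp
  qed
  note E' = exp_polar_has_derivative[folded E_def]
  have smooth_E: "smooth_on X E" if "open X" for X
    unfolding E_def by (intro smooth_on_intros that)
  have f\<sigma>: "f (\<sigma> w) = plane_embedding (E w)" if "w \<in> D" for w
    using inv[OF that] by (simp add: f_def)
  have injE: "inj (frechet_derivative E (at w))" for w
  proof -
    have lin: "linear (frechet_derivative E (at w))"
      by (rule linear_frechet_derivative[OF differentiableI[OF E']])
    have "e = 0" if "frechet_derivative E (at w) e = 0" for e
    proof -
      define c s where "c = cos (fst w)" and "s = sin (fst w)"
      have "snd e * c - fst e * s = 0" "snd e * s + fst e * c = 0"
        using that unfolding frechet_derivative_eqI[OF E'] by (auto simp: prod_eq_iff c_def s_def)
      moreover have "s\<^sup>2 + c\<^sup>2 = 1" by (simp add: c_def s_def)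
      ultimately have "fst e = 0" "snd e = 0" by algebra+
      then show ?thesis by (simp add: prod_eq_iff)
    qed
    then show ?thesis using linear_injective_0[OF lin] by blast
  qed
  have "local_diffeo {(D, \<sigma>)} M complex_plane M' f"
    unfolding local_diffeo_def
  proof (intro conjI ballI)
    show "f ` M \<subseteq> M'" using E0 D' f\<sigma> by (auto simp: M M')
    fix p assume "p \<in> M"
    then obtain w0 where w0: "w0 \<in> D'" "p = \<sigma> w0" by (auto simp: M)
    \<comment> \<open>\<open>E\<close> is periodic in its first coordinate, so an inverse is
      available only near each point.\<close>
    obtain A B G where A: "open A" "A \<subseteq> D'" "w0 \<in> A" and B: "open B" and
      hom: "homeomorphism A B E G" and G: "smooth_on B G"
      using smooth_inverse_function[OF D'(1) smooth_E[OF D'(1)] w0(1) injE] by metis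
    have AD: "A \<subseteq> D" using A D' by blast
    have EB: "B = E ` A" and GB: "G ` B = A" and EG: "\<And>z. z \<in> B \<Longrightarrow> E (G z) = z"
      and GE: "\<And>w. w \<in> A \<Longrightarrow> G (E w) = w"
      using hom by (auto simp: homeomorphism_def)
    have fA: "f (\<sigma> w) = plane_embedding (E w)" if "w \<in> A" for w using f\<sigma> AD that by blast
    have fP: "f ` \<sigma> ` A = plane_embedding ` B"
      unfolding EB image_image using fA by (rule image_cong[OF refl])
    have injf: "inj_on f (\<sigma> ` A)"
    proof (rule inj_onI)
      fix x y assume "x \<in> \<sigma> ` A" "y \<in> \<sigma> ` A" and "f x = f y"
      then obtain u v where "u \<in> A" "v \<in> A" "x = \<sigma> u" "y = \<sigma> v" "E u = E v"
        using fA by (auto simp: prod_eq_iff)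
      then show "x = y" using GE by metis
    qed
    show "\<exists>P. p \<in> P \<and> openin (top_of_set M) P \<and> openin (top_of_set M') (f ` P) \<and>
        inj_on f P \<and> smooth_on_surface {(D, \<sigma>)} P f \<and> smooth_on_surface complex_plane (f ` P) (inv_into P f)"
    proof (intro exI[of _ "\<sigma> ` A"] conjI injf)
      show "p \<in> \<sigma> ` A" using w0 A by blast
      have "openin (top_of_set (\<sigma> ` D)) (\<sigma> ` A)"
        using homeomorphism_imp_open_map[OF g] A(1) AD by (simp add: open_subset)
      then show "openin (top_of_set M) (\<sigma> ` A)"
        using A D' by (auto simp: M elim!: openin_subset_trans)
      \<comment> \<open>The ambient cylinder over \<open>B\<close> cuts the image out of
        \<open>M'\<close>; the origin, absent from \<open>M'\<close>, is not in \<open>B\<close>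
        because \<open>E\<close> never vanishes.\<close>
      have "open {q :: heis. (fst q, fst (snd q)) \<in> B}"
        using open_vimage[OF B, of "\<lambda>q :: heis. (fst q, fst (snd q))"]
        by (simp add: vimage_def continuous_on_Pair continuous_on_fst continuous_on_snd continuous_on_id)
      moreover have "plane_embedding ` B = M' \<inter> {q :: heis. (fst q, fst (snd q)) \<in> B}"
        using E0 by (auto simp: M' EB)
      ultimately show "openin (top_of_set M') (f ` \<sigma> ` A)"
        unfolding fP by (auto simp: openin_open)
      have "smooth_on A (\<lambda>w. plane_embedding (E w))"
        by (rule smooth_on_bounded_linear_compose[OF A(1) bounded_linear_plane_embedding smooth_E[OF A(1)]])
      then have "smooth_on A (f \<circ> \<sigma>)"
        using smooth_on_cong[OF A(1), of "f \<circ> \<sigma>"] fA by simp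
      then show "smooth_on_surface {(D, \<sigma>)} (\<sigma> ` A) f"
        by (simp add: smooth_on_surface_def preM[OF AD])
      have "smooth_on B (\<lambda>z. \<sigma> (G z))"
        by (rule smooth_on_compose[OF B A(1) G smooth_on_subset[OF D(2) AD]]) (use GB in auto)
      moreover have "inv_into (\<sigma> ` A) f (plane_embedding z) = \<sigma> (G z)" if "z \<in> B" for z
      proof -
        have "G z \<in> A" using GB that by blast
        then show ?thesis
          using inv_into_f_f[OF injf, of "\<sigma> (G z)"] fA[of "G z"] EG[OF that] by simp
      qed
      ultimately have "smooth_on B (inv_into (\<sigma> ` A) f \<circ> plane_embedding)"
        using smooth_on_cong[OF B, of "inv_into (\<sigma> ` A) f \<circ> plane_embedding" "\<lambda>z. \<sigma> (G z)"] by simp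
      moreover have "{w \<in> UNIV. plane_embedding w \<in> plane_embedding ` B} = B" by auto
      ultimately show "smooth_on_surface complex_plane (f ` \<sigma> ` A) (inv_into (\<sigma> ` A) f)"
        unfolding complex_plane_eq fP by (simp add: smooth_on_surface_def)
    qed
  qed
  moreover have "smooth_on_surface {(D, \<sigma>)} M l"
  proof -
    have "smooth_on D' (\<lambda>w. 2 * exp (snd w)^2 / q w)"
      by (intro smooth_on_divide smooth_on_intros D' q0 smooth_on_subset[OF smooth_q])
    then have "smooth_on D' (l \<circ> \<sigma>)"
      using smooth_on_cong[OF D'(1), of "l \<circ> \<sigma>" "\<lambda>w. 2 * exp (snd w)^2 / q w"] inv D'(2)
      by (auto simp: l_def subset_iff)
    then show ?thesis by (simp add: smooth_on_surface_def M preM[OF D'(2)])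
  qed
  moreover have "contact_form (f (\<sigma> w)) (frechet_derivative (f \<circ> \<sigma>) (at w) e) =
      l (\<sigma> w) * contact_form (\<sigma> w) (frechet_derivative \<sigma> (at w) e)" if "w \<in> D" "\<sigma> w \<in> M" for w e
  proof -
    have w: "w \<in> D'" using that preM[OF D'(2)] by (auto simp: M)
    have "((\<lambda>w. plane_embedding (E w)) has_derivative
        (\<lambda>e. plane_embedding (frechet_derivative E (at w) e))) (at w)"
      by (rule bounded_linear.has_derivative[OF bounded_linear_plane_embedding
            has_derivative_frechet[OF differentiableI[OF E']]])
    then have "((f \<circ> \<sigma>) has_derivative (\<lambda>e. plane_embedding (frechet_derivative E (at w) e))) (at w)"
      by (rule has_derivative_transform_within_open[OF _ D(1) that(1)]) (simp add: f\<sigma>)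
    then have "contact_form (f (\<sigma> w)) (frechet_derivative (f \<circ> \<sigma>) (at w) e) =
        contact_form (plane_embedding (E w)) (plane_embedding (frechet_derivative E (at w) e))"
      by (simp only: f\<sigma>[OF that(1)] frechet_derivative_eqI)
    also have "\<dots> = 2 * exp (snd w)^2 * fst e"
    proof -
      define c s x where "c = cos (fst w)" and "s = sin (fst w)" and "x = exp (snd w)"
      have "s\<^sup>2 + c\<^sup>2 = 1" by (simp add: c_def s_def)
      then have "2 * (x * c * (x * (snd e * s + fst e * c)) - x * s * (x * (snd e * c - fst e * s))) = 2 * x^2 * fst e"
        by algebra
      then show ?thesis
        unfolding frechet_derivative_eqI[OF E'] by (simp add: E_def c_def s_def x_def)
    qed
    also have "\<dots> = l (\<sigma> w) * (fst e * q w)"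
      using q0[OF w] inv[OF that(1)] by (simp add: l_def)
    also have "fst e * q w = contact_form (\<sigma> w) (frechet_derivative \<sigma> (at w) e)"
      using linear_pair[OF smooth_on_linear_frechet_derivative[OF D(2) that(1)], of e] leg[OF that(1)]
      by (simp add: linear_add[OF linear_contact_form] linear_scale[OF linear_contact_form] q_def)
    finally show ?thesis .
  qed
  ultimately show ?thesis
    unfolding locally_contactomorphic_def M_def[symmetric] M'_def[symmetric]
    by (intro exI[of _ f] exI[of _ l] conjI) simp_all
qed

section \<open>Straight ruled surfaces are minimal\<close>

lemma horizontal_contact_form: "contact_form q (a *\<^sub>R XH q + b *\<^sub>R YH q) = 0"
  by (cases q) (simp add: algebra_simps)

lemma ruled_patch_eq:
  "ruled_patch \<gamma> a b (s, v) =
    (xc (\<gamma> s) + v * a s, yc (\<gamma> s) + v * b s, tc (\<gamma> s) + 2 * v * (yc (\<gamma> s) * a s - xc (\<gamma> s) * b s))"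
  by (cases "\<gamma> s") (simp add: ruled_patch_def xc_def yc_def tc_def algebra_simps)

text \<open>The fields \<open>XH\<close> and \<open>YH\<close> vary along the ruling, but the
  combination with coefficients \<open>a\<close>, \<open>b\<close> does not: its last component 2(ya
  - xb) is unchanged when (x,y) moves along (a,b). So the ruling is horizontal at every one of its
  points.\<close>

lemma ruled_patch_ruling:
  assumes "ruled_patch \<gamma> a b differentiable (at w)"
  shows "frechet_derivative (ruled_patch \<gamma> a b) (at w) (0, 1) =
    a (fst w) *\<^sub>R XH (ruled_patch \<gamma> a b w) + b (fst w) *\<^sub>R YH (ruled_patch \<gamma> a b w)"
proof -
  obtain s v where w: "w = (s, v)" by (cases w)
  let ?V = "a s *\<^sub>R XH (\<gamma> s) + b s *\<^sub>R YH (\<gamma> s)"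
  have "((\<lambda>r. (s, r)) has_derivative (\<lambda>r. (0, r))) (at v)"
    by (auto intro!: derivative_eq_intros)
  from has_derivative_compose[OF this has_derivative_frechet, of "ruled_patch \<gamma> a b"]
  have "((\<lambda>r. ruled_patch \<gamma> a b (s, r)) has_derivative
      (\<lambda>r. frechet_derivative (ruled_patch \<gamma> a b) (at w) (0, r))) (at v)"
    using assms by (simp add: w)
  moreover have "((\<lambda>r. ruled_patch \<gamma> a b (s, r)) has_derivative (\<lambda>r. r *\<^sub>R ?V)) (at v)"
    unfolding ruled_patch_def by (auto intro!: derivative_eq_intros)
  ultimately have "(\<lambda>r. frechet_derivative (ruled_patch \<gamma> a b) (at w) (0, r)) = (\<lambda>r. r *\<^sub>R ?V)"
    by (rule has_derivative_unique)
  from fun_cong[OF this, of 1]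
  have "frechet_derivative (ruled_patch \<gamma> a b) (at w) (0, 1) = ?V" by simp
  also have "\<dots> = a s *\<^sub>R XH (ruled_patch \<gamma> a b w) + b s *\<^sub>R YH (ruled_patch \<gamma> a b w)"
    unfolding w ruled_patch_eq by (cases "\<gamma> s") (simp add: xc_def yc_def tc_def algebra_simps)
  finally show ?thesis by (simp add: w)
qed

text \<open>The contact form kills the ruling direction, which leaves a multiple of the ruling
  turned by a quarter turn.\<close>

lemma ruled_patch_hnormal:
  assumes "ruled_patch \<gamma> a b differentiable (at w)"
  shows "hnormal (ruled_patch \<gamma> a b) w =
    contact_form (ruled_patch \<gamma> a b w) (frechet_derivative (ruled_patch \<gamma> a b) (at w) (1, 0)) *\<^sub>R (- b (fst w), a (fst w))"
proof -
  obtain x y t where "ruled_patch \<gamma> a b w = (x, y, t)" by (metis surj_pair)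
  then show ?thesis
    using hnormal_contact_form[OF assms refl ruled_patch_ruling[OF assms]]
      horizontal_contact_form[of "(x, y, t)"]
    by (simp add: xc_def yc_def)
qed

text \<open>Up to a locally constant sign the unit normal is \<open>(- b s, a s)\<close>, which does
  not depend on the ruling parameter, and the ruling is the horizontal tangent direction.\<close>

lemma zero_horizontal_mean_curvature_ruled:
  assumes I: "open I" and ab: "smooth_on I a" "smooth_on I b" "\<And>s. s \<in> I \<Longrightarrow> (a s)\<^sup>2 + (b s)\<^sup>2 = 1"
    and D: "fst ` D = I" and patch: "regular_patch D (ruled_patch \<gamma> a b)"
  shows "zero_horizontal_mean_curvature {(D, ruled_patch \<gamma> a b)}"
  unfolding zero_horizontal_mean_curvature_def
proof
  let ?\<sigma> = "ruled_patch \<gamma> a b"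
  let ?R = "{(D, ?\<sigma>)}"
  fix p assume p: "p \<in> noncharacteristic_points ?R"
  have oD: "open D" and sm: "smooth_on D ?\<sigma>" using patch by (auto simp: regular_patch_def)
  note diff = smooth_on_differentiable[OF sm]
  note reg = regular_surface_single[OF patch]
  obtain w where w: "w \<in> D" "p = ?\<sigma> w" "hnormal ?\<sigma> w \<noteq> 0"
    using p unfolding noncharacteristic_points_single[OF patch] by auto
  obtain h where h: "has_horizontal_mean_curvature ?R p h"
    using horizontal_graph_exists[OF reg p] horizontal_graph.mean_curvature by metis
  define q where "q = (\<lambda>w. contact_form (?\<sigma> w) (frechet_derivative ?\<sigma> (at w) (1, 0)))"
  \<comment> \<open>The normal is \<epsilon> times \<open>(- b, a)\<close> at \<open>w\<close>, so
    the horizontal tangent is \<epsilon> times the ruling direction, the image of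
    \<open>(0, \<epsilon>)\<close>.\<close>
  define \<epsilon> where "\<epsilon> = sgn (q w)"
  have hn: "hnormal ?\<sigma> x = q x *\<^sub>R (- b (fst x), a (fst x))" if "x \<in> D" for x
    unfolding q_def by (rule ruled_patch_hnormal[OF diff[OF that]])
  have unit: "sgn (- b (fst x), a (fst x)) = (- b (fst x), a (fst x))" if "x \<in> D" for x
  proof -
    have "fst x \<in> I" using D that by blast
    then have "norm (- b (fst x), a (fst x)) = 1" using ab(3) by (simp add: norm_Pair add.commute)
    then show ?thesis by (simp add: sgn_div_norm)
  qed
  have sgn_hn: "sgn (hnormal ?\<sigma> x) = sgn (q x) *\<^sub>R (- b (fst x), a (fst x))" if "x \<in> D" for x
    by (simp only: hn[OF that] sgn_scaleR unit[OF that])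
  have q0: "q w \<noteq> 0" using w(3) unfolding hn[OF w(1)] by (metis scaleR_zero_left)
  have "frechet_derivative ?\<sigma> (at w) (0, \<epsilon>) = \<epsilon> *\<^sub>R frechet_derivative ?\<sigma> (at w) (0, 1)"
    using linear_scale[OF smooth_on_linear_frechet_derivative[OF sm w(1)], of \<epsilon> "(0, 1)"] by simp
  also have "\<dots> = horizontal_tangent (sgn (hnormal ?\<sigma> w)) (?\<sigma> w)"
    unfolding ruled_patch_ruling[OF diff[OF w(1)]] sgn_hn[OF w(1)] \<epsilon>_def[symmetric]
    by (simp add: horizontal_tangent_def algebra_simps)
  finally have e: "frechet_derivative ?\<sigma> (at w) (0, \<epsilon>) = horizontal_tangent (sgn (hnormal ?\<sigma> w)) (?\<sigma> w)" .
  have zero: "frechet_derivative (\<lambda>x. k (sgn (hnormal ?\<sigma> x))) (at w) (0, \<epsilon>) = 0"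
    if k: "bounded_linear k" for k :: "real \<times> real \<Rightarrow> real"
  proof -
    \<comment> \<open>On this neighbourhood \<open>q\<close> keeps the sign it has at
      \<open>w\<close>, so the sign in the unit normal is constant there.\<close>
    define N where "N = {x \<in> D. q x \<in> {r. 0 < r * q w}}"
    have "continuous_on D q"
      unfolding q_def by (rule smooth_on_imp_continuous_on[OF smooth_on_contact_form[OF oD sm]])
    moreover have "open {r. 0 < r * q w}" by (intro open_Collect_less continuous_intros)
    ultimately have N: "open N" unfolding N_def using oD by (intro open_Int_vimage)
    have wN: "w \<in> N" using w(1) q0 by (auto simp: N_def zero_less_mult_iff)
    have eq: "k (\<epsilon> *\<^sub>R (- b (fst x), a (fst x))) = k (sgn (hnormal ?\<sigma> x))" if "x \<in> N" for x
    proof -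
      have "sgn (q x) = \<epsilon>" using that q0 by (auto simp: N_def \<epsilon>_def sgn_if zero_less_mult_iff)
      then show ?thesis using sgn_hn[of x] that by (simp add: N_def)
    qed
    have "((\<lambda>x. k (\<epsilon> *\<^sub>R (- b (fst x), a (fst x)))) has_derivative
        (\<lambda>e. k (\<epsilon> *\<^sub>R (- frechet_derivative b (at (fst w)) (fst e), frechet_derivative a (at (fst w)) (fst e))))) (at w)"
    proof -
      have s: "fst w \<in> I" using D w(1) by blast
      note ab' = smooth_on_has_derivative[OF ab(1) s] smooth_on_has_derivative[OF ab(2) s]
      have "(fst has_derivative fst) (at w)"
        by (rule bounded_linear_imp_has_derivative[OF bounded_linear_fst])
      note ab'' = has_derivative_compose[OF this ab'(1)] has_derivative_compose[OF this ab'(2)]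
      show ?thesis
        by (intro bounded_linear.has_derivative[OF k] has_derivative_scaleR_right has_derivative_Pair
            has_derivative_minus ab'')
    qed
    then have "((\<lambda>x. k (sgn (hnormal ?\<sigma> x))) has_derivative
        (\<lambda>e. k (\<epsilon> *\<^sub>R (- frechet_derivative b (at (fst w)) (fst e), frechet_derivative a (at (fst w)) (fst e))))) (at w)"
      by (rule has_derivative_transform_within_open[OF _ N wN eq])
    moreover have "frechet_derivative a (at (fst w)) 0 = 0" "frechet_derivative b (at (fst w)) 0 = 0"
      using smooth_on_linear_frechet_derivative[OF ab(1)] smooth_on_linear_frechet_derivative[OF ab(2)]
        D w(1) linear_0 by blast+
    ultimately show ?thesis
      using linear_0[OF bounded_linear.linear[OF k]] by (simp add: frechet_derivative_eqI flip: zero_prod_def)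
  qed
  have "h = 0"
    using horizontal_mean_curvature_in_patch[OF reg _ w(1,3) h[unfolded w(2)] e refl]
      zero[OF bounded_linear_fst] zero[OF bounded_linear_snd] by simp
  then show "horizontal_mean_curvature ?R p = 0"
    using horizontal_mean_curvature_eqI[OF reg p h] by simp
qed

section \<open>Surfaces of zero horizontal mean curvature are ruled\<close>

text \<open>The squared norm of \<open>h\<close> grows at a rate of at most \<open>2 * C\<close>
  times itself, so the weighted square \<open>?\<phi>\<close> is nonincreasing; it starts at zero
  and is never negative.\<close>

lemma gronwall_zero:
  fixes h :: "real \<Rightarrow> 'a::real_inner"
  assumes h': "\<And>v. v \<in> {0..b} \<Longrightarrow> (h has_vector_derivative h' v) (at v)"
    and bound: "\<And>v. v \<in> {0..b} \<Longrightarrow> norm (h' v) \<le> C * norm (h v)"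
    and b: "0 \<le> b" and h0: "h 0 = 0"
  shows "h b = 0"
proof -
  let ?\<phi> = "\<lambda>v. exp (- 2 * C * v) * (h v \<bullet> h v)"
  have "\<exists>y. DERIV ?\<phi> v :> y \<and> y \<le> 0" if "0 \<le> v" "v \<le> b" for v
  proof -
    let ?y = "exp (- 2 * C * v) * (2 * (h v \<bullet> h' v) - 2 * C * (h v \<bullet> h v))"
    have hd: "(h has_derivative (\<lambda>x. x *\<^sub>R h' v)) (at v)"
      using h' that by (simp add: has_vector_derivative_def)
    have "DERIV ?\<phi> v :> ?y"
      unfolding has_field_derivative_def
      by (rule derivative_eq_intros hd refl | simp)+ (auto simp: fun_eq_iff algebra_simps inner_commute)
    moreover have "h v \<bullet> h' v \<le> norm (h v) * norm (h' v)" by (rule norm_cauchy_schwarz)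
    moreover have "norm (h v) * norm (h' v) \<le> norm (h v) * (C * norm (h v))"
      using bound that by (intro mult_left_mono) auto
    ultimately have "DERIV ?\<phi> v :> ?y \<and> ?y \<le> 0"
      by (auto simp: dot_square_norm power2_eq_square mult_le_0_iff algebra_simps)
    then show ?thesis by blast
  qed
  from DERIV_nonpos_imp_nonincreasing[OF b this] have "?\<phi> b \<le> 0" using h0 by simp
  then have "h b \<bullet> h b \<le> 0" by (simp add: mult_le_0_iff)
  then show ?thesis by (metis inner_eq_zero_iff inner_ge_zero order_antisym)
qed

text \<open>Smoothness gives continuity of the derivative for each fixed direction. Bounds for the
  two basis directions add up to one that is uniform in the direction.\<close>

lemma frechet_derivative_bounded_on_compact:
  fixes f :: "real \<times> real \<Rightarrow> 'a::real_normed_vector"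
  assumes f: "smooth_on B f" and K: "compact K" "K \<subseteq> B"
  obtains M where "\<And>z x. z \<in> K \<Longrightarrow> norm (frechet_derivative f (at z) x) \<le> M * norm x" "0 \<le> M"
proof -
  have "\<exists>M > 0. \<forall>z\<in>K. norm (frechet_derivative f (at z) v) \<le> M" for v
    using compact_imp_bounded[OF compact_continuous_image[OF continuous_on_subset[OF
            smooth_on_imp_continuous_on[OF smooth_on_frechet_derivative[OF f]] K(2)] K(1)], of v]
    by (auto simp: bounded_pos)
  then obtain M where M: "\<And>v. M v > 0" "\<And>v z. z \<in> K \<Longrightarrow> norm (frechet_derivative f (at z) v) \<le> M v"
    by metis
  show thesis
  proof
    show "0 \<le> M (1, 0) + M (0, 1)" using M(1) less_imp_le add_nonneg_nonneg by metis
    fix z x assume z: "z \<in> K"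
    let ?D = "frechet_derivative f (at z)"
    have abs: "\<bar>fst x\<bar> \<le> norm x" "\<bar>snd x\<bar> \<le> norm x"
      using norm_fst_le[of "fst x" "snd x"] norm_snd_le[of "snd x" "fst x"] by simp_all
    have "norm (?D x) \<le> \<bar>fst x\<bar> * norm (?D (1, 0)) + \<bar>snd x\<bar> * norm (?D (0, 1))"
      using linear_pair[OF smooth_on_linear_frechet_derivative[OF f], of z x] z K(2)
        norm_triangle_ineq[of "fst x *\<^sub>R ?D (1, 0)" "snd x *\<^sub>R ?D (0, 1)"] by auto
    also have "\<dots> \<le> norm x * M (1, 0) + norm x * M (0, 1)"
      using M z abs by (intro add_mono mult_mono) auto
    finally show "norm (?D x) \<le> (M (1, 0) + M (0, 1)) * norm x" by (simp add: algebra_simps)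
  qed
qed

text \<open>Horizontal lines are straight: moving \<open>q\<close> along
  \<open>(snd n, - fst n)\<close> does not alter the last component
  \<open>2 * yc q * snd n + 2 * xc q * fst n\<close>.\<close>

lemma horizontal_tangent_along_line:
  "horizontal_tangent n (q + r *\<^sub>R horizontal_tangent n q) = horizontal_tangent n q"
  by (simp add: horizontal_tangent_eq xc_def yc_def algebra_simps)

text \<open>The first two components contribute \<open>2 * d\<close>. In the third, each product is
  split so that the change of base point is weighted by \<open>n'\<close>, costing
  \<open>4 * d\<close>, and the change of normal by \<open>q\<close>, costing
  \<open>4 * R * d\<close>.\<close>

lemma horizontal_tangent_diff_bound:
  fixes q q' :: heis and n n' :: "real \<times> real"
  assumes R: "norm q \<le> R" and n': "norm n' \<le> 1" and d: "norm (q - q') \<le> d" "norm (n - n') \<le> d"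
  shows "norm (horizontal_tangent n q - horizontal_tangent n' q') \<le> (6 + 4 * R) * d"
proof -
  have pair: "\<bar>fst z\<bar> \<le> norm z" "\<bar>snd z\<bar> \<le> norm z" for z :: "real \<times> real"
    using norm_fst_le[of "fst z" "snd z"] norm_snd_le[of "snd z" "fst z"] by simp_all
  have xy: "\<bar>xc z\<bar> \<le> norm z" "\<bar>yc z\<bar> \<le> norm z" for z :: heis
  proof -
    show "\<bar>xc z\<bar> \<le> norm z" using norm_fst_le[of "fst z" "snd z"] by (simp add: xc_def)
    have "\<bar>yc z\<bar> \<le> norm (snd z)" using pair(1) by (simp add: yc_def)
    also have "\<dots> \<le> norm z" using norm_snd_le[of "snd z" "fst z"] by simp
    finally show "\<bar>yc z\<bar> \<le> norm z" .
  qed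
  define n1 n2 m1 m2 x y x' y' where defs: "n1 = fst n" "n2 = snd n" "m1 = fst n'" "m2 = snd n'"
    "x = xc q" "y = yc q" "x' = xc q'" "y' = yc q'"
  have nd: "\<bar>n1 - m1\<bar> \<le> d" "\<bar>n2 - m2\<bar> \<le> d" "\<bar>m1\<bar> \<le> 1" "\<bar>m2\<bar> \<le> 1"
    using pair[of "n - n'"] pair[of n'] d n' by (auto simp: defs)
  have qd: "\<bar>x - x'\<bar> \<le> d" "\<bar>y - y'\<bar> \<le> d" "\<bar>x\<bar> \<le> R" "\<bar>y\<bar> \<le> R"
    using xy[of "q - q'"] xy[of q] d R by (auto simp: defs xc_def yc_def)
  have nonneg: "0 \<le> d" "0 \<le> R" using order_trans[OF norm_ge_zero] d(1) R by blast+
  have "\<bar>(y - y') * m2\<bar> \<le> d * 1" "\<bar>(x - x') * m1\<bar> \<le> d * 1" "\<bar>y * (n2 - m2)\<bar> \<le> R * d" "\<bar>x * (n1 - m1)\<bar> \<le> R * d"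
    unfolding abs_mult by (rule mult_mono[OF qd(2) nd(4) nonneg(1) abs_ge_zero]
        mult_mono[OF qd(1) nd(3) nonneg(1) abs_ge_zero] mult_mono[OF qd(4) nd(2) nonneg(2) abs_ge_zero]
        mult_mono[OF qd(3) nd(1) nonneg(2) abs_ge_zero])+
  moreover have "(2 * y * n2 + 2 * x * n1) - (2 * y' * m2 + 2 * x' * m1)
      = 2 * ((y - y') * m2) + 2 * ((x - x') * m1) + 2 * (y * (n2 - m2)) + 2 * (x * (n1 - m1))"
    by (simp add: algebra_simps)
  ultimately have t: "\<bar>(2 * y * n2 + 2 * x * n1) - (2 * y' * m2 + 2 * x' * m1)\<bar> \<le> 4 * d + 4 * (R * d)"
    by linarith
  have "norm (horizontal_tangent n q - horizontal_tangent n' q') =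
      norm (n2 - m2, m1 - n1, (2 * y * n2 + 2 * x * n1) - (2 * y' * m2 + 2 * x' * m1))"
    by (simp add: horizontal_tangent_eq defs)
  also have "\<dots> \<le> \<bar>n2 - m2\<bar> + (\<bar>m1 - n1\<bar> + \<bar>(2 * y * n2 + 2 * x * n1) - (2 * y' * m2 + 2 * x' * m1)\<bar>)"
    unfolding real_norm_def[symmetric] by (rule order_trans[OF norm_Pair_le add_left_mono[OF norm_Pair_le]])
  also have "\<dots> \<le> d + (d + (4 * d + 4 * (R * d)))"
    using nd(1,2) t by (intro add_mono) (simp_all only: abs_minus_commute)
  also have "\<dots> = (6 + 4 * R) * d" by (simp add: algebra_simps)
  finally show ?thesis .
qed

section \<open>Horizontal lines contained in the surface\<close>

context horizontal_graph
begin

lemma norm_n: "z \<in> B \<Longrightarrow> norm (n z) = 1"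
  using n(2) by (simp add: norm_prod_def)

text \<open>The deviation of the surface from the horizontal line tangent to it, taken together with the
  variation of the normal along the line, satisfies a homogeneous linear differential inequality.\<close>

lemma horizontal_line_in_surface:
  assumes S: "regular_surface S" "zero_horizontal_mean_curvature S" and z: "z \<in> B"
    and V_def: "V = horizontal_tangent (n z) (T z)"
    and inB: "\<And>\<tau>. \<tau> \<in> {0..1} \<Longrightarrow> z + (\<tau> * r) *\<^sub>R L V \<in> B"
  shows "T (z + r *\<^sub>R L V) = T z + r *\<^sub>R V"
proof -
  \<comment> \<open>The line is reparametrised over the unit interval, so that \<open>r\<close> may
    have either sign.\<close>
  let ?Q = "\<lambda>\<tau>. z + (\<tau> * r) *\<^sub>R L V" and ?l = "\<lambda>\<tau>. T z + (\<tau> * r) *\<^sub>R V"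
  let ?h = "\<lambda>\<tau>. (?l \<tau> - T (?Q \<tau>), n z - n (?Q \<tau>))"
  let ?T' = "\<lambda>\<tau>. frechet_derivative T (at (?Q \<tau>))" and ?n' = "\<lambda>\<tau>. frechet_derivative n (at (?Q \<tau>))"
  let ?h' = "\<lambda>\<tau>. (r *\<^sub>R V - ?T' \<tau> (r *\<^sub>R L V), - ?n' \<tau> (r *\<^sub>R L V))"
  have K: "compact (?Q ` {0..1})" "?Q ` {0..1} \<subseteq> B"
    using inB by (auto intro!: compact_continuous_image continuous_intros)
  obtain MT where MT: "\<And>\<tau> x. \<tau> \<in> {0..1} \<Longrightarrow> norm (?T' \<tau> x) \<le> MT * norm x" "0 \<le> MT"
    using frechet_derivative_bounded_on_compact[OF T K] by (metis imageI)
  obtain Mn where Mn: "\<And>\<tau> x. \<tau> \<in> {0..1} \<Longrightarrow> norm (?n' \<tau> x) \<le> Mn * norm x" "0 \<le> Mn"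
    using frechet_derivative_bounded_on_compact[OF n(1) K] by (metis imageI)
  obtain BL where BL: "\<And>x. norm (L x) \<le> norm x * BL" "0 \<le> BL"
    using bounded_linear.nonneg_bounded[OF L] by metis
  define R where "R = norm (T z) + \<bar>r\<bar> * norm V"
  \<comment> \<open>The factor |r| is the speed of the reparametrisation, the middle factor bounds
    the derivative of the deviation by \<open>\<Delta>\<close> below, and the last one bounds
    \<open>\<Delta>\<close> by the deviation.\<close>
  define C where "C = \<bar>r\<bar> * (1 + (MT + Mn) * BL) * (6 + 4 * R)"
  have R0: "0 \<le> R" by (simp add: R_def)
  have "?h 1 = 0"
  proof (rule gronwall_zero[where h = "?h" and h' = "?h'" and C = C])
    fix \<tau> :: real assume \<tau>: "\<tau> \<in> {0..1}"
    have Q': "(?Q has_derivative (\<lambda>x. x *\<^sub>R r *\<^sub>R L V)) (at \<tau>)"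
      by (auto intro!: derivative_eq_intros simp: algebra_simps)
    have lin: "linear (?T' \<tau>)" "linear (?n' \<tau>)"
      using smooth_on_linear_frechet_derivative[OF T inB[OF \<tau>]]
        smooth_on_linear_frechet_derivative[OF n(1) inB[OF \<tau>]] .
    have TQ: "((\<lambda>\<tau>. T (?Q \<tau>)) has_derivative (\<lambda>x. ?T' \<tau> (x *\<^sub>R r *\<^sub>R L V))) (at \<tau>)"
      by (rule has_derivative_compose[OF Q' smooth_on_has_derivative[OF T inB[OF \<tau>]]])
    have nQ: "((\<lambda>\<tau>. n (?Q \<tau>)) has_derivative (\<lambda>x. ?n' \<tau> (x *\<^sub>R r *\<^sub>R L V))) (at \<tau>)"
      by (rule has_derivative_compose[OF Q' smooth_on_has_derivative[OF n(1) inB[OF \<tau>]]])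
    have l': "(?l has_derivative (\<lambda>x. x *\<^sub>R r *\<^sub>R V)) (at \<tau>)"
      by (auto intro!: derivative_eq_intros simp: algebra_simps)
    have "(?h has_derivative (\<lambda>x. (x *\<^sub>R r *\<^sub>R V - ?T' \<tau> (x *\<^sub>R r *\<^sub>R L V), 0 - ?n' \<tau> (x *\<^sub>R r *\<^sub>R L V)))) (at \<tau>)"
      by (intro has_derivative_Pair has_derivative_diff l' TQ nQ has_derivative_const)
    then show "(?h has_vector_derivative ?h' \<tau>) (at \<tau>)"
      unfolding has_vector_derivative_def
      by (simp add: linear_scale[OF lin(1)] linear_scale[OF lin(2)] scaleR_diff_right)
    \<comment> \<open>The error in direction at the comparison point. The true tangent there is
      reproduced by the differential of \<open>T\<close> after \<open>L\<close> and killed by that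
      of \<open>n\<close> after \<open>L\<close>, so only \<open>\<Delta>\<close> survives in the
      derivative of the deviation.\<close>
    define \<Delta> where "\<Delta> = V - horizontal_tangent (n (?Q \<tau>)) (T (?Q \<tau>))"
    \<comment> \<open>Reading \<open>V\<close> at the current point of the line makes the two
      tangents comparable at points whose distance is part of the deviation.\<close>
    have V: "V = horizontal_tangent (n z) (?l \<tau>)"
      unfolding V_def by (rule horizontal_tangent_along_line[symmetric])
    have "norm \<Delta> \<le> (6 + 4 * R) * norm (?h \<tau>)"
    proof -
      have "norm (?l \<tau>) \<le> norm (T z) + norm ((\<tau> * r) *\<^sub>R V)" by (rule norm_triangle_ineq)
      also have "\<dots> \<le> R"
        using \<tau> by (auto simp: R_def abs_mult mult_left_le_one_le intro!: mult_right_mono)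
      finally have lR: "norm (?l \<tau>) \<le> R" .
      show ?thesis
        unfolding \<Delta>_def by (subst V, rule horizontal_tangent_diff_bound[OF lR])
          (use norm_n[OF inB[OF \<tau>]] norm_fst_le norm_snd_le in auto)
    qed
    moreover have "norm (?h' \<tau>) \<le> \<bar>r\<bar> * ((1 + (MT + Mn) * BL) * norm \<Delta>)"
    proof -
      have LV: "L V = L \<Delta> + L (horizontal_tangent (n (?Q \<tau>)) (T (?Q \<tau>)))"
        using linear_add[OF bounded_linear.linear[OF L]] by (metis \<Delta>_def diff_add_cancel)
      have "?T' \<tau> (L V) = ?T' \<tau> (L \<Delta>) + (V - \<Delta>)"
        using arg_cong[OF LV, of "?T' \<tau>"] linear_add[OF lin(1)] n_tangent[OF inB[OF \<tau>]]
        by (simp add: \<Delta>_def)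
      then have "V - ?T' \<tau> (L V) = \<Delta> - ?T' \<tau> (L \<Delta>)" by simp
      moreover have "?n' \<tau> (L V) = ?n' \<tau> (L \<Delta>)"
        using arg_cong[OF LV, of "?n' \<tau>"] linear_add[OF lin(2)]
          normal_constant_along_tangent[OF S inB[OF \<tau>]] by simp
      ultimately have h'eq: "?h' \<tau> = r *\<^sub>R (\<Delta> - ?T' \<tau> (L \<Delta>), - ?n' \<tau> (L \<Delta>))"
        by (simp add: linear_scale[OF lin(1)] linear_scale[OF lin(2)] flip: scaleR_diff_right)
      have "norm (\<Delta> - ?T' \<tau> (L \<Delta>), - ?n' \<tau> (L \<Delta>)) \<le> norm (\<Delta> - ?T' \<tau> (L \<Delta>)) + norm (- ?n' \<tau> (L \<Delta>))"
        by (rule norm_Pair_le)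
      also have "\<dots> \<le> (norm \<Delta> + norm (?T' \<tau> (L \<Delta>))) + norm (?n' \<tau> (L \<Delta>))"
        using norm_triangle_ineq4[of \<Delta> "?T' \<tau> (L \<Delta>)"] by simp
      also have "\<dots> \<le> (norm \<Delta> + MT * (norm \<Delta> * BL)) + Mn * (norm \<Delta> * BL)"
        using order_trans[OF MT(1)[OF \<tau>] mult_left_mono[OF BL(1) MT(2)]]
          order_trans[OF Mn(1)[OF \<tau>] mult_left_mono[OF BL(1) Mn(2)]] by (intro add_mono) auto
      also have "\<dots> = (1 + (MT + Mn) * BL) * norm \<Delta>" by (simp add: algebra_simps)
      finally show ?thesis unfolding h'eq norm_scaleR by (intro mult_left_mono) auto
    qed
    moreover have "\<bar>r\<bar> * ((1 + (MT + Mn) * BL) * norm \<Delta>) \<le> \<bar>r\<bar> * ((1 + (MT + Mn) * BL) * ((6 + 4 * R) * norm (?h \<tau>)))"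
      using calculation(1) MT(2) Mn(2) BL(2) by (intro mult_left_mono) auto
    ultimately show "norm (?h' \<tau>) \<le> C * norm (?h \<tau>)" by (simp add: C_def mult.assoc)
  next
    show "?h 0 = 0" by (simp add: prod_eq_iff)
  qed simp
  then show ?thesis by (simp add: prod_eq_iff)
qed

end

text \<open>If the given directrix runs along a line, moving it along the rulings by \<open>(s - s\<^sub>1) (s - s\<^sub>2)\<close> while
  fixing two of its points bends it, unless all rulings project into that same line; then it can be
  moved to a vertical one.\<close>

lemma exists_directrix:
  fixes x y a b :: "real \<Rightarrow> real"
  assumes I: "open I" and sm: "smooth_on I x" "smooth_on I y" "smooth_on I a" "smooth_on I b"
    and unit: "\<And>s. s \<in> I \<Longrightarrow> (a s)\<^sup>2 + (b s)\<^sup>2 = 1"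
  obtains k where "smooth_on I k" "\<not> straight_line_curve I (\<lambda>s. (x s + k s * a s, y s + k s * b s))"
proof (cases "straight_line_curve I (\<lambda>s. (x s, y s))")
  case False
  then show thesis using that[of "\<lambda>_. 0"] I by (simp add: smooth_on_const)
next
  case True
  then obtain u where u: "\<And>s t. s \<in> I \<Longrightarrow> t \<in> I \<Longrightarrow> \<exists>c. (x s, y s) - (x t, y t) = c *\<^sub>R u"
    by (force simp: straight_line_curve_def collinear_def)
  from True obtain s1 s2 where s12: "s1 \<in> I" "s2 \<in> I" "(x s2, y s2) \<noteq> (x s1, y s1)"
    unfolding straight_line_curve_def constant_on_def by metis
  define d where "d = (x s2, y s2) - (x s1, y s1)"
  have parallel: "\<exists>c. w = c *\<^sub>R d" if "w = c *\<^sub>R v" "d = c' *\<^sub>R v" for w v :: "real \<times> real" and c c'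
  proof -
    have "c' \<noteq> 0" using that(2) s12(3) by (auto simp: d_def zero_prod_def)
    then have "w = (c / c') *\<^sub>R d" using that by simp
    then show ?thesis by blast
  qed
  have m: "\<exists>c. (x s, y s) - (x s1, y s1) = c *\<^sub>R d" if "s \<in> I" for s
    using parallel u[OF that s12(1)] u[OF s12(2,1)] d_def by metis
  \<comment> \<open>\<open>k\<close> vanishes at \<open>s1\<close> and \<open>s2\<close>: the moved
    curve keeps two distinct points of the old one, so if it is again a line, it is the same
    line.\<close>
  define k where "k = (\<lambda>s. (s - s1) * (s - s2))"
  show thesis
  proof (cases "straight_line_curve I (\<lambda>s. (x s + k s * a s, y s + k s * b s))")
    case False
    moreover have "smooth_on I k" unfolding k_def using I by (intro smooth_on_intros)
    ultimately show thesis using that by blast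
  next
    case True
    then obtain v where v: "\<And>s t. s \<in> I \<Longrightarrow> t \<in> I \<Longrightarrow>
        \<exists>c. (x s + k s * a s, y s + k s * b s) - (x t + k t * a t, y t + k t * b t) = c *\<^sub>R v"
      by (force simp: straight_line_curve_def collinear_def)
    have k12: "k s1 = 0" "k s2 = 0" by (auto simp: k_def)
    have ruling: "\<exists>c. (k s * a s, k s * b s) = c *\<^sub>R d" if s: "s \<in> I" for s
    proof -
      obtain c c' where "(x s + k s * a s, y s + k s * b s) - (x s1, y s1) = c *\<^sub>R v" "d = c' *\<^sub>R v"
        using v[OF s s12(1)] v[OF s12(2,1)] k12 by (auto simp: d_def)
      then obtain e where e: "(x s + k s * a s, y s + k s * b s) - (x s1, y s1) = e *\<^sub>R d"
        using parallel by blast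
      obtain e' where "(x s, y s) - (x s1, y s1) = e' *\<^sub>R d" using m[OF s] by blast
      then have "(k s * a s, k s * b s) = (e - e') *\<^sub>R d"
        using e by (auto simp: prod_eq_iff algebra_simps)
      then show ?thesis by blast
    qed
    \<comment> \<open>\<open>q\<close> measures how far the ruling is from being parallel to the
      line. It can be nonzero only at the two zeros of \<open>k\<close>; its nonvanishing set is
      open and finite, hence empty.\<close>
    define q where "q = (\<lambda>s. a s * snd d - b s * fst d)"
    have "{s \<in> I. q s \<in> - {0}} \<subseteq> {s1, s2}"
    proof
      fix s assume s: "s \<in> {s \<in> I. q s \<in> - {0}}"
      then obtain c where c: "k s * a s = c * fst d" "k s * b s = c * snd d"
        using ruling[of s] by (auto simp: prod_eq_iff)
      then have "k s * q s = 0" unfolding q_def by algebra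
      then show "s \<in> {s1, s2}" using s by (simp add: k_def)
    qed
    moreover have "continuous_on I q"
      unfolding q_def by (intro continuous_intros smooth_on_imp_continuous_on sm)
    then have "open {s \<in> I. q s \<in> - {0}}" using I by (rule open_Int_vimage) auto
    ultimately have "{s \<in> I. q s \<in> - {0}} = {}"
      using finite_imp_not_open finite_subset by blast
    then have q0: "q s = 0" if "s \<in> I" for s using that by blast
    \<comment> \<open>Now each unit ruling is parallel to the line. Sliding back by the component of
      the displacement along the ruling brings every point over the base point at
      \<open>s1\<close>.\<close>
    define k' where "k' = (\<lambda>s. - ((x s - x s1) * a s + (y s - y s1) * b s))"
    have "x s + k' s * a s = x s1 \<and> y s + k' s * b s = y s1" if s: "s \<in> I" for s
    proof -
      obtain c where c: "x s - x s1 = c * fst d" "y s - y s1 = c * snd d"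
        using m[OF s] by (auto simp: prod_eq_iff)
      show ?thesis
        using c q0[OF s] unit[OF s] unfolding k'_def q_def by algebra
    qed
    then have "(\<lambda>s. (x s + k' s * a s, y s + k' s * b s)) constant_on I"
      by (auto simp: constant_on_def)
    moreover have "smooth_on I k'"
      unfolding k'_def using I by (intro smooth_on_intros sm)
    ultimately show thesis using that[of k'] by (simp add: straight_line_curve_def)
  qed
qed

section \<open>Change of directrix\<close>

lemma smooth_on_ruled_patch:
  assumes I: "open I" "smooth_on I \<gamma>" "smooth_on I a" "smooth_on I b" and D: "open D" "fst ` D \<subseteq> I"
  shows "smooth_on D (ruled_patch \<gamma> a b)"
proof -
  have c: "smooth_on D (\<lambda>w. g (fst w))" if "smooth_on I g" for g :: "real \<Rightarrow> 'a::real_normed_vector"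
    using smooth_on_compose[OF D(1) I(1) _ that D(2)] smooth_on_fst[OF D(1) smooth_on_ident[OF D(1)]] .
  have \<gamma>: "smooth_on I (\<lambda>s. h (\<gamma> s))" if "bounded_linear h" for h :: "heis \<Rightarrow> real"
    by (rule smooth_on_bounded_linear_compose[OF I(1) that I(2)])
  have "smooth_on D (\<lambda>w. (xc (\<gamma> (fst w)) + snd w * a (fst w), yc (\<gamma> (fst w)) + snd w * b (fst w),
      tc (\<gamma> (fst w)) + 2 * snd w * (yc (\<gamma> (fst w)) * a (fst w) - xc (\<gamma> (fst w)) * b (fst w))))"
    by (intro smooth_on_intros D(1) c[OF I(3)] c[OF I(4)] c[OF \<gamma>] bounded_linear_coords)
  moreover have "ruled_patch \<gamma> a b = (\<lambda>w. (xc (\<gamma> (fst w)) + snd w * a (fst w), yc (\<gamma> (fst w)) + snd w * b (fst w),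
      tc (\<gamma> (fst w)) + 2 * snd w * (yc (\<gamma> (fst w)) * a (fst w) - xc (\<gamma> (fst w)) * b (fst w))))"
  proof
    fix w :: "real \<times> real"
    show "ruled_patch \<gamma> a b w = (xc (\<gamma> (fst w)) + snd w * a (fst w), yc (\<gamma> (fst w)) + snd w * b (fst w),
      tc (\<gamma> (fst w)) + 2 * snd w * (yc (\<gamma> (fst w)) * a (fst w) - xc (\<gamma> (fst w)) * b (fst w)))"
      using ruled_patch_eq[of \<gamma> a b "fst w" "snd w"] by simp
  qed
  ultimately show ?thesis by (simp only:)
qed

text \<open>Moving the directrix along its own rulings leaves the ruling vectors unchanged, so it
  only shears the parameters.\<close>

lemma ruled_patch_shift:
  "ruled_patch (\<lambda>s. ruled_patch \<gamma> a b (s, k s)) a b (s, v) = ruled_patch \<gamma> a b (s, v + k s)"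
  by (simp add: ruled_patch_eq xc_def yc_def tc_def algebra_simps)

text \<open>Removes the condition on the directrix: a shear by the \<open>k\<close> of
  \<open>exists_directrix\<close> replaces \<gamma> by an admissible curve with the same point set.
  Regularity is assumed in the form of a left inverse \<open>g\<close> because this passes through
  the shear as \<open>down \<circ> g\<close>.\<close>

lemma straight_ruled_surface_reparam:
  assumes A: "smooth_on I \<gamma>" "smooth_on I a" "smooth_on I b" "\<And>s. s \<in> I \<Longrightarrow> (a s)\<^sup>2 + (b s)\<^sup>2 = 1"
    and D: "open D" "connected D" "D \<noteq> {}" "fst ` D = I"
    and g: "\<And>w. w \<in> D \<Longrightarrow> g (ruled_patch \<gamma> a b w) = w"
      "\<And>w. w \<in> D \<Longrightarrow> g differentiable (at (ruled_patch \<gamma> a b w))"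
  shows "\<exists>R. straight_ruled_surface R \<and> surface_points R = ruled_patch \<gamma> a b ` D"
proof -
  have I: "open I" "is_interval I" "I \<noteq> {}"
  proof -
    show "open I" using open_image_fst[OF D(1)] D(4) by simp
    have "connected I" using connected_continuous_image[OF continuous_on_fst[OF continuous_on_id] D(2)] D(4) by simp
    then show "is_interval I" by (simp add: is_interval_connected_1)
    show "I \<noteq> {}" using D by blast
  qed
  have sm\<gamma>: "smooth_on I (\<lambda>s. xc (\<gamma> s))" "smooth_on I (\<lambda>s. yc (\<gamma> s))" "smooth_on I (\<lambda>s. tc (\<gamma> s))"
    by (rule smooth_on_bounded_linear_compose[OF I(1) _ A(1)]; rule bounded_linear_coords)+
  obtain k where k: "smooth_on I k"
    "\<not> straight_line_curve I (\<lambda>s. (xc (\<gamma> s) + k s * a s, yc (\<gamma> s) + k s * b s))"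
    using exists_directrix[OF I(1) sm\<gamma>(1,2) A(2,3,4)] by metis
  define \<gamma>' where "\<gamma>' = (\<lambda>s. ruled_patch \<gamma> a b (s, k s))"
  define up where "up = (\<lambda>w :: real \<times> real. (fst w, snd w + k (fst w)))"
  define down where "down = (\<lambda>w :: real \<times> real. (fst w, snd w - k (fst w)))"
  define D' where "D' = down ` D"
  have up_down: "up (down w) = w" "down (up w) = w" for w
    by (simp_all add: up_def down_def)
  have patch_up: "ruled_patch \<gamma>' a b w = ruled_patch \<gamma> a b (up w)" for w
    using ruled_patch_shift[of \<gamma> a b k "fst w" "snd w"] by (simp add: \<gamma>'_def up_def)
  have contk: "continuous_on X (\<lambda>w. k (fst w))" if "fst ` X \<subseteq> I" for X :: "(real \<times> real) set"
    using continuous_on_compose2[OF smooth_on_imp_continuous_on[OF k(1)] continuous_on_fst[OF continuous_on_id] that] .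
  \<comment> \<open>As a preimage under \<open>up\<close> the new domain is open; as an image under
    \<open>down\<close> it is connected.\<close>
  have D'_eq: "D' = {w \<in> I \<times> UNIV. up w \<in> D}"
  proof -
    have "w \<in> D'" if "up w \<in> D" for w using that up_down(2)[of w] unfolding D'_def by (metis imageI)
    moreover have "up w \<in> D \<and> fst w \<in> I" if w: "w \<in> D'" for w
    proof -
      obtain w' where w': "w' \<in> D" "w = down w'" using w unfolding D'_def by blast
      then have "fst w \<in> fst ` D" by (simp add: down_def)
      then show ?thesis using w' up_down(1)[of w'] D(4) by simp
    qed
    ultimately show ?thesis by (auto simp: mem_Times_iff)
  qed
  have D': "open D'" "connected D'" "fst ` D' = I"
  proof -
    have "open (I \<times> (UNIV :: real set))" using I(1) by (simp add: open_Times)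
    moreover have "continuous_on (I \<times> UNIV) up"
      unfolding up_def by (intro continuous_intros contk) auto
    ultimately show "open D'" unfolding D'_eq using D(1) by (intro open_Int_vimage)
    have "continuous_on D down"
      unfolding down_def by (intro continuous_intros contk) (use D(4) in auto)
    then show "connected D'" unfolding D'_def using D(2) by (rule connected_continuous_image)
    show "fst ` D' = I" using D(4) by (simp add: D'_def down_def image_image)
  qed
  have sm\<gamma>': "smooth_on I \<gamma>'"
    unfolding \<gamma>'_def ruled_patch_eq
    by (intro smooth_on_intros I(1) sm\<gamma> k A)
  have upD: "up w \<in> D" if "w \<in> D'" for w using that by (simp add: D'_eq)
  have patch: "regular_patch D' (ruled_patch \<gamma>' a b)"
  proof (rule regular_patchI[OF D'(1)])
    show "smooth_on D' (ruled_patch \<gamma>' a b)"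
      by (rule smooth_on_ruled_patch[OF I(1) sm\<gamma>' A(2,3) D'(1)]) (simp add: D'(3))
    fix w assume w: "w \<in> D'"
    show "(down \<circ> g) (ruled_patch \<gamma>' a b w) = w"
      using g(1)[OF upD[OF w]] up_down by (simp add: patch_up)
    show "down \<circ> g differentiable at (ruled_patch \<gamma>' a b w)"
    proof (rule differentiable_chain_at)
      show "g differentiable at (ruled_patch \<gamma>' a b w)"
        using g(2)[OF upD[OF w]] by (simp add: patch_up)
      have "down differentiable (at (up w))"
      proof -
        have "fst (up w) \<in> I" using w D'(3) by (auto simp: up_def)
        note k' = has_derivative_compose[OF bounded_linear_imp_has_derivative[OF bounded_linear_fst]
            smooth_on_has_derivative[OF k(1) this]]
        show ?thesis
          unfolding down_def
          by (rule differentiableI has_derivative_Pair has_derivative_diff k' bounded_linear_imp_has_derivative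
              bounded_linear_fst bounded_linear_snd)+
      qed
      then show "down differentiable at (g (ruled_patch \<gamma>' a b w))"
        using g(1)[OF upD[OF w]] by (simp add: patch_up)
    qed
  qed
  have "prC \<circ> \<gamma>' = (\<lambda>s. (xc (\<gamma> s) + k s * a s, yc (\<gamma> s) + k s * b s))"
    by (auto simp: fun_eq_iff \<gamma>'_def ruled_patch_eq)
  then have "straight_ruled_surface {(D', ruled_patch \<gamma>' a b)}"
    unfolding straight_ruled_surface_def
    using I sm\<gamma>' k A D' patch
    by (intro exI[of _ I] exI[of _ \<gamma>'] exI[of _ a] exI[of _ b] exI[of _ D']) simp
  moreover have "surface_points {(D', ruled_patch \<gamma>' a b)} = ruled_patch \<gamma> a b ` D"
    by (simp add: surface_points_def D'_def image_image patch_up up_down)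
  ultimately show ?thesis by blast
qed

section \<open>Ruled parametrisation of small portions\<close>

context horizontal_graph
begin

text \<open>In the parameter plane the rulings are straight segments along \<open>e\<close>. Those
  issuing from a transversal line \<open>c\<close> fill a neighbourhood, and
  \<open>horizontal_line_in_surface\<close> shows that \<open>T\<close> carries them to horizontal
  lines.\<close>

lemma locally_ruled:
  assumes S: "regular_surface S" "zero_horizontal_mean_curvature S"
    and p: "p \<in> W" "p \<in> surface_points S"
  obtains W' where "open W'" "p \<in> W'"
    "\<And>P. openin (top_of_set (surface_points S)) P \<Longrightarrow> connected P \<Longrightarrow> P \<noteq> {} \<Longrightarrow> P \<subseteq> W' \<Longrightarrow>
      \<exists>R. straight_ruled_surface R \<and> surface_points R = P"
proof -
  define z0 where "z0 = L p"
  have z0: "z0 \<in> B" "T z0 = p"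
  proof -
    obtain z where "z \<in> B" "p = T z" using p W(2) by blast
    then show "z0 \<in> B" "T z0 = p" using L_T[of z] by (simp_all add: z0_def)
  qed
  define e where "e = (\<lambda>z. L (horizontal_tangent (n z) (T z)))"
  have sm_coord: "smooth_on B (\<lambda>z. h (T z))" if "bounded_linear h" for h :: "heis \<Rightarrow> real"
    by (rule smooth_on_bounded_linear_compose[OF B that T])
  have "smooth_on B (\<lambda>z. horizontal_tangent (n z) (T z))"
    unfolding horizontal_tangent_eq by (intro smooth_on_intros B n(1) sm_coord bounded_linear_coords)
  then have sm_e: "smooth_on B e"
    unfolding e_def by (rule smooth_on_bounded_linear_compose[OF B L])
  have e0: "e z0 \<noteq> 0"
  proof
    assume "e z0 = 0"
    then have "horizontal_tangent (n z0) (T z0) = 0"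
      using n_tangent[OF z0(1)] linear_0[OF smooth_on_linear_frechet_derivative[OF T z0(1)]] by (simp add: e_def)
    then have "n z0 = 0" by (simp add: horizontal_tangent_eq prod_eq_iff)
    then show False using n(2)[OF z0(1)] by simp
  qed
  \<comment> \<open>Perpendicular to \<open>e z0\<close>, so that \<open>c\<close> crosses the
    rulings and the columns \<open>k\<close> and \<open>e z0\<close> of the differential of
    \<open>Q\<close> at the origin are independent.\<close>
  define k where "k = (- snd (e z0), fst (e z0))"
  define c where "c = (\<lambda>s. z0 + s *\<^sub>R k)"
  define Q where "Q = (\<lambda>w. c (fst w) + snd w *\<^sub>R e (c (fst w)))"
  define O1 where "O1 = {w \<in> (UNIV :: (real \<times> real) set). c (fst w) \<in> B}"
  have O1: "open O1"
    unfolding O1_def c_def using B by (intro open_Int_vimage continuous_intros) auto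
  have c_O1: "smooth_on X (\<lambda>w. c (fst w))" if "open X" for X :: "(real \<times> real) set"
    unfolding c_def by (intro smooth_on_intros that)
  have Q: "smooth_on O1 Q"
    unfolding Q_def
    by (intro smooth_on_intros O1 c_O1 smooth_on_compose[OF O1 B c_O1[OF O1] sm_e]) (auto simp: O1_def)
  define O2 where "O2 = {w \<in> O1. Q w \<in> B}"
  have O2: "open O2" unfolding O2_def by (rule open_Int_vimage[OF smooth_on_imp_continuous_on[OF Q] O1 B])
  have Q0: "Q 0 = z0" by (simp add: Q_def c_def)
  have "0 \<in> O2" using Q0 z0 by (simp add: O2_def O1_def c_def)
  \<comment> \<open>A ball about the origin contains \<open>(s, \<tau> * v)\<close> along with
    \<open>(s, v)\<close> for \<tau> between 0 and 1, which keeps the entire segment over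
    \<open>s\<close> inside \<open>B\<close>.\<close>
  then obtain \<delta> where \<delta>: "\<delta> > 0" "ball 0 \<delta> \<subseteq> O2" using O2 openE by blast
  have smQ: "smooth_on (ball 0 \<delta>) Q" using smooth_on_subset[OF Q] \<delta>(2) by (auto simp: O2_def)
  have DQ: "(Q has_derivative (\<lambda>x. fst x *\<^sub>R k + snd x *\<^sub>R e z0)) (at 0)"
  proof -
    have c': "((\<lambda>w. c (fst w)) has_derivative (\<lambda>x. fst x *\<^sub>R k)) (at (0 :: real \<times> real))"
      unfolding c_def by (auto intro!: derivative_eq_intros)
    have "(e has_derivative frechet_derivative e (at z0)) (at (c (fst (0 :: real \<times> real))))"
      using smooth_on_has_derivative[OF sm_e z0(1)] by (simp add: c_def)
    from has_derivative_compose[OF c' this]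
    have ec': "((\<lambda>w. e (c (fst w))) has_derivative (\<lambda>x. frechet_derivative e (at z0) (fst x *\<^sub>R k))) (at (0 :: real \<times> real))" .
    have "(Q has_derivative (\<lambda>x. fst x *\<^sub>R k + (snd (0 :: real \<times> real) *\<^sub>R frechet_derivative e (at z0) (fst x *\<^sub>R k) + snd x *\<^sub>R e (c (fst (0 :: real \<times> real)))))) (at 0)"
      unfolding Q_def
      by (rule has_derivative_add[OF c' has_derivative_scaleR[OF
              bounded_linear_imp_has_derivative[OF bounded_linear_snd] ec']])
    then show ?thesis by (simp add: c_def)
  qed
  have "inj (frechet_derivative Q (at 0))"
  proof -
    have lin: "linear (frechet_derivative Q (at 0))"
      by (rule linear_frechet_derivative[OF differentiableI[OF DQ]])
    have "x = 0" if "frechet_derivative Q (at 0) x = 0" for x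
    proof -
      define e1 e2 where "e1 = fst (e z0)" and "e2 = snd (e z0)"
      have eqs: "snd x * e1 - fst x * e2 = 0" "fst x * e1 + snd x * e2 = 0"
        using that unfolding frechet_derivative_eqI[OF DQ] by (auto simp: prod_eq_iff k_def e1_def e2_def)
      have "e1\<^sup>2 + e2\<^sup>2 \<noteq> 0" using e0 by (auto simp: e1_def e2_def prod_eq_iff)
      moreover have "fst x * (e1\<^sup>2 + e2\<^sup>2) = 0" "snd x * (e1\<^sup>2 + e2\<^sup>2) = 0"
        using eqs by algebra+
      ultimately have "fst x = 0" "snd x = 0" by (metis mult_eq_0_iff)+
      then show ?thesis by (simp add: prod_eq_iff)
    qed
    then show ?thesis using linear_injective_0[OF lin] by blast
  qed
  from smooth_inverse_function[OF open_ball smQ _ this] \<delta>(1)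
  obtain A B' G where A: "open A" "A \<subseteq> ball 0 \<delta>" "0 \<in> A" and B': "open B'" "Q 0 \<in> B'"
    and hom: "homeomorphism A B' Q G" and G: "smooth_on B' G" by (metis centre_in_ball)
  have QA: "Q ` A = B'" and GQ: "\<And>w. w \<in> A \<Longrightarrow> G (Q w) = w" and QG: "\<And>z. z \<in> B' \<Longrightarrow> Q (G z) = z"
    and GB': "G ` B' = A"
    using hom by (auto simp: homeomorphism_def)
  have AO: "A \<subseteq> O2" using A(2) \<delta>(2) by blast
  have B'B: "B' \<subseteq> B" using AO QA by (auto simp: O2_def)
  define \<gamma> where "\<gamma> = (\<lambda>s. T (c s))"
  define a where "a = (\<lambda>s. snd (n (c s)))"
  define b where "b = (\<lambda>s. - fst (n (c s)))"
  define \<sigma> where "\<sigma> = ruled_patch \<gamma> a b"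
  have \<sigma>_eq: "\<sigma> w = T (Q w)" if "w \<in> ball 0 \<delta>" for w
  proof -
    obtain s v where w: "w = (s, v)" by (cases w)
    have seg: "(s, \<tau> * v) \<in> O2" if "\<tau> \<in> {0..1}" for \<tau>
    proof -
      have "\<bar>\<tau> * v\<bar> \<le> \<bar>v\<bar>" using that by (auto simp: abs_mult intro: mult_left_le_one_le)
      then have "(\<tau> * v)\<^sup>2 \<le> v\<^sup>2" by (simp add: abs_le_square_iff)
      then have "norm (s, \<tau> * v) \<le> norm (s, v)" by (simp add: norm_Pair)
      then show ?thesis using \<open>w \<in> ball 0 \<delta>\<close> \<delta>(2) w by auto
    qed
    have cs: "c s \<in> B" using seg[of 1] by (simp add: O2_def O1_def)
    have "c s + (\<tau> * v) *\<^sub>R L (horizontal_tangent (n (c s)) (T (c s))) \<in> B" if "\<tau> \<in> {0..1}" for \<tau>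
      using seg[OF that] by (simp add: O2_def Q_def e_def)
    from horizontal_line_in_surface[OF S cs refl this]
    have "T (Q w) = T (c s) + v *\<^sub>R horizontal_tangent (n (c s)) (T (c s))"
      by (simp add: Q_def w e_def)
    also have "\<dots> = \<sigma> w"
      by (simp add: \<sigma>_def ruled_patch_def w \<gamma>_def a_def b_def horizontal_tangent_def)
    finally show ?thesis by simp
  qed
  define W' where "W' = {q \<in> W. L q \<in> B'}"
  show thesis
  proof
    show "open W'"
      unfolding W'_def using W(1) B'(1) L linear_continuous_on by (intro open_Int_vimage) auto
    show "p \<in> W'" using p B'(2) Q0 by (simp add: W'_def z0_def)
    fix P assume P: "openin (top_of_set (surface_points S)) P" "connected P" "P \<noteq> {}" "P \<subseteq> W'"
    have PS: "P \<subseteq> surface_points S" using openin_imp_subset[OF P(1)] by simp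
    have TL: "T (L q) = q" "L q \<in> B'" if "q \<in> P" for q
    proof -
      have "q \<in> T ` B" using that P(4) PS W(2) by (auto simp: W'_def)
      then show "T (L q) = q" using L_T by auto
      show "L q \<in> B'" using that P(4) by (auto simp: W'_def)
    qed
    define D where "D = (\<lambda>q. G (L q)) ` P"
    obtain O' where O': "open O'" "P = surface_points S \<inter> O'" using P(1) by (auto simp: openin_open)
    have LP: "L ` P = {z \<in> B'. T z \<in> O'}"
    proof -
      have "z \<in> L ` P" if z: "z \<in> B'" "T z \<in> O'" for z
      proof -
        have "T z \<in> surface_points S" using z(1) B'B W(2) by blast
        then have "T z \<in> P" using O' z by blast
        moreover have "L (T z) = z" using L_T z(1) B'B by blast
        ultimately show ?thesis by (metis imageI)
      qed
      moreover have "L q \<in> B' \<and> T (L q) \<in> O'" if "q \<in> P" for q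
        using TL[OF that] that O'(2) by auto
      ultimately show ?thesis by blast
    qed
    have DA: "D \<subseteq> A" using TL(2) GB' by (auto simp: D_def)
    have "D = {w \<in> A. Q w \<in> L ` P}"
    proof -
      have "Q w \<in> L ` P" if "w \<in> D" for w
      proof -
        obtain q where q: "q \<in> P" "w = G (L q)" using \<open>w \<in> D\<close> by (auto simp: D_def)
        then show ?thesis using QG[OF TL(2)[OF q(1)]] by simp
      qed
      moreover have "w \<in> D" if "w \<in> A" "Q w \<in> L ` P" for w
      proof -
        obtain q where q: "q \<in> P" "Q w = L q" using \<open>Q w \<in> L ` P\<close> by blast
        then have "w = G (L q)" using GQ[OF \<open>w \<in> A\<close>] by simp
        then show ?thesis using q(1) by (simp add: D_def)
      qed
      ultimately show ?thesis using DA by blast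
    qed
    moreover have "open (L ` P)"
      unfolding LP
      by (rule open_Int_vimage[OF continuous_on_subset[OF smooth_on_imp_continuous_on[OF T] B'B] B'(1) O'(1)])
    moreover have "continuous_on A Q" using hom by (simp add: homeomorphism_def)
    ultimately have oD: "open D" using A(1) open_Int_vimage by metis
    have "continuous_on P (\<lambda>q. G (L q))"
      by (rule continuous_on_compose2[OF smooth_on_imp_continuous_on[OF G] linear_continuous_on[OF L]])
        (use TL(2) in auto)
    then have conD: "connected D" unfolding D_def using P(2) by (rule connected_continuous_image)
    have cI: "c s \<in> B" if "s \<in> fst ` D" for s
      using that DA AO by (auto simp: O2_def O1_def)
    have I: "open (fst ` D)" by (rule open_image_fst[OF oD])
    have smc: "smooth_on (fst ` D) c" unfolding c_def by (intro smooth_on_intros I)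
    have comp: "smooth_on (fst ` D) (\<lambda>s. f (c s))" if "smooth_on B f" for f :: "real \<times> real \<Rightarrow> 'x::real_normed_vector"
      by (rule smooth_on_compose[OF I B smc that]) (use cI in blast)
    have \<sigma>D: "\<sigma> w = T (Q w)" if "w \<in> D" for w using \<sigma>_eq that DA A(2) by blast
    have L\<sigma>: "L (\<sigma> w) = Q w" "Q w \<in> B'" if "w \<in> D" for w
    proof -
      show "Q w \<in> B'" using that DA QA by blast
      then show "L (\<sigma> w) = Q w" using \<sigma>D[OF that] L_T[of "Q w"] B'B by auto
    qed
    have "\<exists>R. straight_ruled_surface R \<and> surface_points R = ruled_patch \<gamma> a b ` D"
    proof (rule straight_ruled_surface_reparam[OF _ _ _ _ oD conD _ refl, where g = "G \<circ> L"])
      show "smooth_on (fst ` D) \<gamma>" unfolding \<gamma>_def by (rule comp[OF T])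
      show "smooth_on (fst ` D) a" "smooth_on (fst ` D) b"
        unfolding a_def b_def by (intro smooth_on_intros I comp[OF n(1)])+
      show "(a s)\<^sup>2 + (b s)\<^sup>2 = 1" if "s \<in> fst ` D" for s
        using n(2)[OF cI[OF that]] by (simp add: a_def b_def add.commute)
      show "D \<noteq> {}" using P(3) by (simp add: D_def)
      fix w assume w: "w \<in> D"
      show "(G \<circ> L) (ruled_patch \<gamma> a b w) = w"
        unfolding \<sigma>_def[symmetric] using L\<sigma>[OF w] GQ[of w] DA w by auto
      show "G \<circ> L differentiable at (ruled_patch \<gamma> a b w)"
        unfolding \<sigma>_def[symmetric]
        using L\<sigma>[OF w] smooth_on_differentiable[OF G] bounded_linear_imp_differentiable[OF L]
        by (intro differentiable_chain_at) auto
    qed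
    moreover have "ruled_patch \<gamma> a b ` D = P"
    proof -
      have "\<sigma> (G (L q)) = q" if "q \<in> P" for q
        using \<sigma>D[of "G (L q)"] QG TL[OF that] that by (simp add: D_def)
      then show ?thesis by (auto simp: D_def image_image \<sigma>_def[symmetric])
    qed
    ultimately show "\<exists>R. straight_ruled_surface R \<and> surface_points R = P" by simp
  qed
qed

end

text \<open>Portions are taken connected because a ruled surface has one patch with connected
  domain. Only point sets are compared, as the ruled patch may induce the opposite
  orientation.\<close>

theorem theorem1p1:
  shows "(\<forall>R. straight_ruled_surface R \<longrightarrow>
            zero_horizontal_mean_curvature R \<and> locally_contactomorphic R complex_plane) \<and>
         (\<forall>S. regular_surface S \<and> zero_horizontal_mean_curvature S \<longrightarrow>
            (\<forall>p\<in>noncharacteristic_points S. \<exists>W. open W \<and> p \<in> W \<and>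
               (\<forall>P. openin (top_of_set (surface_points S)) P \<and> connected P \<and> P \<noteq> {} \<and>
                    P \<subseteq> W \<and> P \<subseteq> noncharacteristic_points S \<longrightarrow>
                    (\<exists>R. straight_ruled_surface R \<and> surface_points R = P))))"
proof (intro conjI allI impI ballI)
  fix R assume "straight_ruled_surface R"
  then obtain I \<gamma> a b D where R: "open I" "smooth_on I a" "smooth_on I b" "\<forall>s\<in>I. (a s)\<^sup>2 + (b s)\<^sup>2 = 1"
    "fst ` D = I" "regular_patch D (ruled_patch \<gamma> a b)" "R = {(D, ruled_patch \<gamma> a b)}"
    unfolding straight_ruled_surface_def by (elim exE conjE) (rule that)
  show "zero_horizontal_mean_curvature R"
    using zero_horizontal_mean_curvature_ruled[OF R(1-3) _ R(5,6)] R(4,7) by blast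
  have "smooth_on D (ruled_patch \<gamma> a b)" using R(6) by (simp add: regular_patch_def)
  from ruled_patch_ruling[OF smooth_on_differentiable[OF this]]
  have "contact_form (ruled_patch \<gamma> a b w) (frechet_derivative (ruled_patch \<gamma> a b) (at w) (0, 1)) = 0"
    if "w \<in> D" for w
    using that by (simp only: horizontal_contact_form)
  then show "locally_contactomorphic R complex_plane"
    unfolding R(7) by (rule legendrian_patch_contactomorphic[OF R(6)])
next
  fix S p assume S: "regular_surface S \<and> zero_horizontal_mean_curvature S"
    and p: "p \<in> noncharacteristic_points S"
  then obtain L B T W n where "horizontal_graph S L B T W n" "p \<in> W"
    using horizontal_graph_exists by metis
  moreover have "p \<in> surface_points S" using p by (simp add: noncharacteristic_points_def)
  ultimately obtain W' where "open W'" "p \<in> W'"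
    and W': "\<And>P. openin (top_of_set (surface_points S)) P \<Longrightarrow> connected P \<Longrightarrow> P \<noteq> {} \<Longrightarrow> P \<subseteq> W' \<Longrightarrow>
      \<exists>R. straight_ruled_surface R \<and> surface_points R = P"
    using horizontal_graph.locally_ruled[of S L B T W n p] S by blast
  then show "\<exists>W. open W \<and> p \<in> W \<and>
      (\<forall>P. openin (top_of_set (surface_points S)) P \<and> connected P \<and> P \<noteq> {} \<and>
        P \<subseteq> W \<and> P \<subseteq> noncharacteristic_points S \<longrightarrow>
        (\<exists>R. straight_ruled_surface R \<and> surface_points R = P))"
    by (intro exI[of _ W'] conjI allI impI) (assumption, assumption, elim conjE, rule W')
qed

end
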